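(* Assume the coefficients are centered with unit variance and admit a finite moment of order $\beta\ge3$, i.e. $\mathbb E[|a_1|^\beta]<\infty$. Let $X$ be a random variable on $[0,2\pi]$, independent of the coefficients, such that for some $\alpha>0$ and $C>0$, \[ \forall k\in\mathbb Z\setminus\{0\},\quad |\widehat{\mathbb P_X}(k)|\le \frac{C}{|k|^\alpha},\qquad \widehat{\mathbb P_X}(k):=\mathbb E_X[e^{ikX}]. \] If $\beta>\frac{2}{\min(\alpha,1/2)}$, then $\mathbb P$-almost surely, $f_n(X)$ converges in distribution under $\mathbb P_X$ to $\mathcal N(0,1)$ as $n\to\infty$.
   Context: On a probability space $(\Omega,\mathcal F,\mathbb P)$ let $(a_k)_{k\ge1}$ and $(b_k)_{k\ge1}$ be random variables such that all the $a_k,b_k$ are mutually independent with the common distribution of $a_1$. For $n\ge1$ and $t\in\mathbb R$ let $f_n(t)=\frac{1}{\sqrt n}\sum_{k=1}^n \big(a_k\cos(kt)+b_k\sin(kt)\big)$. $X$ is realized on a product space with law $\mathbb P\otimes\mathbb P_X$; $\mathbb E_X,\mathbb P_X$ denote expectation/probability with respect to $X$ only, the coefficients being fixed. *)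

theory Defs
  imports "HOL-Probability.Probability"
begin

definition trig_poly :: "(nat \<Rightarrow> 'a \<Rightarrow> real) \<Rightarrow> (nat \<Rightarrow> 'a \<Rightarrow> real) \<Rightarrow> nat \<Rightarrow> 'a \<Rightarrow> real \<Rightarrow> real"
  where "trig_poly a b n \<omega> t =
    (1 / sqrt (real n)) * (\<Sum>k=1..n. a k \<omega> * cos (real k * t) + b k \<omega> * sin (real k * t))"

end

(* Condition on the coefficients and let phi_n(xi) be the characteristic function of f_n(X) under P_X.
   Expanding |phi_n(xi) - exp(-xi^2/2)|^2 with two independent copies x, y of X and integrating the
   coefficients first, independence and a third-order Taylor expansion leave an error of order n^(-1/2)
   plus a multiple of the mean over (x, y) of |D_n(x - y)|, where D_n(u) = (1/n) sum_{k<=n} cos(k u).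
   The Fourier decay of X bounds the latter by n^(-delta), so the second moment is O((1 + xi^4) n^(-delta)).

   Along n = J^p with p large this is summable in J, even after summing over the grid of all xi = r/J
   with |r| <= J^2. The moment condition forces beta > 4, and a finite fourth moment is enough to fill
   the gaps: the maximum over J^p <= n <= (J+1)^p of the fourth power of |S_n - S_{J^p}| is dominated by
   a dyadic chaining sum of mean O(gap^2), which is summable relative to J^(2p). Hence almost surely
   phi_n(xi) converges for all xi simultaneously, and Levy's continuity theorem applies. *)

theory Submission
  imports Defs
begin

subsection \<open>Sums of independent variables\<close>

text \<open>A mean-square error n^(-delta) with delta at most 1/4 is not summable, so a sparse
  subsequence is unavoidable and the gaps become the real difficulty. Along any integers m_1 < m_2 <
  ... the relative gaps (m_(J+1) - m_J) / m_J have a divergent sum, so second moments of the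
  increments, proportional to these gaps, are never summable. Fourth moments are proportional to the
  squares of the gaps, here of order 1/J^2. No supremum over t is taken: at a given \<xi>,
  characteristic functions under P_X differ by at most |\<xi>| times the L^1(P_X) distance of the
  functions, so fluctuations are measured in L^4(P_X) and averaged over the coefficients by Fubini.
  The same bound handles uncountably many \<xi>: moving to a grid point costs 1/J times the L^1(P_X)
  norm of f_n, and the polynomial factor 1 + \<xi>^4 is cheap enough to let the grid widen with J.
  D_n(x - y) is the covariance of f_n(x) and f_n(y): its smallness in mean says that two independent
  copies of X usually see nearly uncorrelated values.\<close>

lemma AE_tendsto_zero_of_summable_nn_integral:
  fixes Y :: "nat \<Rightarrow> 'a \<Rightarrow> real"
  assumes [measurable]: "\<And>j. Y j \<in> borel_measurable M"
    and bound: "\<And>j. (\<integral>\<^sup>+ \<omega>. ennreal (norm (Y j \<omega>)) \<partial>M) \<le> ennreal (s j)"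
    and s: "\<And>j. 0 \<le> s j" "summable s"
  shows "AE \<omega> in M. (\<lambda>j. Y j \<omega>) \<longlonglongrightarrow> 0"
proof -
  \<comment> \<open>Borel-Cantelli in series form: a finite mean of the sum makes the sum finite
    almost surely, hence its terms vanish.\<close>
  have "(\<integral>\<^sup>+ \<omega>. (\<Sum>j. ennreal (norm (Y j \<omega>))) \<partial>M) = (\<Sum>j. \<integral>\<^sup>+ \<omega>. ennreal (norm (Y j \<omega>)) \<partial>M)"
    by (rule nn_integral_suminf) simp
  also have "\<dots> \<le> (\<Sum>j. ennreal (s j))"
    by (intro suminf_le bound) auto
  also have "\<dots> = ennreal (\<Sum>j. s j)"
    using s by (simp add: suminf_ennreal2)
  finally have "(\<integral>\<^sup>+ \<omega>. (\<Sum>j. ennreal (norm (Y j \<omega>))) \<partial>M) \<noteq> \<infinity>"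
    by (auto simp: top_unique)
  then have "AE \<omega> in M. (\<Sum>j. ennreal (norm (Y j \<omega>))) \<noteq> \<infinity>"
    by (intro nn_integral_PInf_AE) auto
  then show ?thesis
  proof eventually_elim
    case (elim \<omega>)
    then have "summable (\<lambda>j. norm (Y j \<omega>))"
      by (intro summable_suminf_not_top) auto
    then show ?case
      by (rule summable_LIMSEQ_zero[OF summable_norm_cancel])
  qed
qed

lemma abs_exp_minus_diff_le:
  fixes u v :: real
  assumes "0 \<le> u" "0 \<le> v"
  shows "\<bar>exp (- u) - exp (- v)\<bar> \<le> \<bar>u - v\<bar>"
proof -
  have *: "exp (- u) - exp (- v) \<le> v - u" if "0 \<le> u" "u \<le> v" for u v :: real
  proof -
    have "exp (- u) - exp (- v) = exp (- u) * (1 - exp (u - v))"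
      by (simp add: right_diff_distrib flip: exp_add)
    also have "\<dots> \<le> 1 * (1 - exp (u - v))"
      using that by (intro mult_right_mono) auto
    also have "\<dots> \<le> v - u"
    proof -
      have "1 - e \<le> v - u" if "1 + (u - v) \<le> e" for e using that by linarith
      from this[OF exp_ge_add_one_self] show ?thesis by simp
    qed
    finally show ?thesis .
  qed
  show ?thesis
  proof (cases "u \<le> v")
    case True
    then have "exp (- v) \<le> exp (- u)" by simp
    then show ?thesis using *[of u v] True assms by linarith
  next
    case False
    then have "exp (- u) \<le> exp (- v)" by simp
    then show ?thesis using *[of v u] False assms by linarith
  qed
qed

lemma abs_exp_minus_Taylor_le:
  fixes u :: real
  assumes "0 \<le> u"
  shows "\<bar>exp (- u) - (1 - u)\<bar> \<le> u\<^sup>2 / 2"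
proof -
  obtain t where "exp (- u) = (\<Sum>m<2. (- u) ^ m / fact m) + exp t / fact 2 * (- u) ^ 2" "\<bar>t\<bar> \<le> \<bar>-u\<bar>" "t \<le> 0"
  proof (cases "u = 0")
    case True
    then show ?thesis by (intro that[of 0]) (auto simp: numeral_2_eq_2)
  next
    case False
    then have "- u < 0" using assms by simp
    from Maclaurin_minus[of "-u" 2 "\<lambda>n. exp" exp] this obtain t where
      "- u < t \<and> t < 0 \<and> exp (- u) = (\<Sum>m<2. exp 0 / fact m * (- u) ^ m) + exp t / fact 2 * (- u)\<^sup>2"
      by (auto intro: DERIV_exp)
    then show ?thesis by (intro that[of t]) auto
  qed
  then have "exp (- u) - (1 - u) = exp t * (u\<^sup>2 / 2)" "exp t \<le> 1"
    by (auto simp: numeral_2_eq_2)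
  moreover have "exp t * (u\<^sup>2 / 2) \<le> u\<^sup>2 / 2"
    using \<open>exp t \<le> 1\<close> by (intro mult_left_le_one_le) auto
  moreover have "0 \<le> exp t * (u\<^sup>2 / 2)" by simp
  ultimately show ?thesis by linarith
qed

text \<open>Deliberately asymmetric: convexity alone would give 8 and 8, and the chaining recursion
  cannot afford an 8 in front of its recursive term. Young's inequality with weights 5 and 5/4, used
  twice, gives 5 * 25 = 125 and (5/4)^3 = 125/64.\<close>

lemma add_power4_le:
  fixes x y :: real
  shows "(x + y) ^ 4 \<le> 125 * x ^ 4 + 2 * y ^ 4"
proof -
  have young: "(a + b)\<^sup>2 \<le> 5 * a\<^sup>2 + 5 / 4 * b\<^sup>2" for a b :: real
  proof -
    have "0 \<le> (2 * a - b / 2)\<^sup>2" by simp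
    then show ?thesis by (simp add: power2_eq_square algebra_simps)
  qed
  have "(x + y) ^ 4 = ((x + y)\<^sup>2)\<^sup>2" by simp
  also have "\<dots> \<le> (5 * x\<^sup>2 + 5 / 4 * y\<^sup>2)\<^sup>2"
    by (intro power_mono young) simp
  also have "\<dots> \<le> 5 * (5 * x\<^sup>2)\<^sup>2 + 5 / 4 * (5 / 4 * y\<^sup>2)\<^sup>2"
    by (rule young)
  also have "\<dots> = 125 * x ^ 4 + 125 / 64 * y ^ 4"
    by (simp add: power_mult_distrib power2_eq_square power4_eq_xxxx)
  also have "\<dots> \<le> 125 * x ^ 4 + 2 * y ^ 4"
    by simp
  finally show ?thesis .
qed

text \<open>Trades every lower power for the fourth, so that a single fourth-moment bound and a
  single factor \<open>1 + \<xi> ^ 4\<close> carry all error terms.\<close>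

lemma power_le_one_plus_power4:
  fixes y :: real
  assumes "k \<le> 4"
  shows "\<bar>y\<bar> ^ k \<le> 1 + y ^ 4"
proof (cases "\<bar>y\<bar> \<le> 1")
  case True
  then have "\<bar>y\<bar> ^ k \<le> 1" by (simp add: power_le_one)
  moreover have "0 \<le> y ^ 4" by simp
  ultimately show ?thesis by linarith
next
  case False
  then have "\<bar>y\<bar> ^ k \<le> \<bar>y\<bar> ^ 4" using assms by (intro power_increasing) auto
  then show ?thesis by simp
qed

context prob_space
begin

lemma integrable_power_le4:
  fixes g :: "'a \<Rightarrow> real"
  assumes "integrable M (\<lambda>x. g x ^ 4)" "k \<le> 4" and [measurable]: "g \<in> borel_measurable M"
  shows "integrable M (\<lambda>x. g x ^ k)"
  by (rule Bochner_Integration.integrable_bound[of _ "\<lambda>x. 1 + g x ^ 4"])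
     (use assms power_le_one_plus_power4 in \<open>auto simp: power_abs\<close>)

lemma power2_expectation_le:
  fixes g :: "'a \<Rightarrow> real"
  assumes "integrable M g" "integrable M (\<lambda>x. (g x)\<^sup>2)"
  shows "(expectation g)\<^sup>2 \<le> expectation (\<lambda>x. (g x)\<^sup>2)"
proof -
  have "0 \<le> expectation (\<lambda>x. (g x - expectation g)\<^sup>2)" by simp
  also have "\<dots> = expectation (\<lambda>x. (g x)\<^sup>2) - (expectation g)\<^sup>2"
    using assms by (intro variance_eq) auto
  finally show ?thesis by simp
qed

lemma power4_expectation_abs_le:
  fixes g :: "'a \<Rightarrow> real"
  assumes [measurable]: "g \<in> borel_measurable M" and B: "\<And>x. \<bar>g x\<bar> \<le> B"
  shows "(expectation (\<lambda>x. \<bar>g x\<bar>)) ^ 4 \<le> expectation (\<lambda>x. \<bar>g x\<bar> ^ 4)"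
proof -
  have int: "integrable M (\<lambda>x. \<bar>g x\<bar> ^ k)" for k
    by (rule integrable_const_bound[of _ "B ^ k"]) (auto intro!: power_mono B simp: power_abs)
  have "(expectation (\<lambda>x. \<bar>g x\<bar>)) ^ 4 = ((expectation (\<lambda>x. \<bar>g x\<bar>))\<^sup>2)\<^sup>2" by simp
  also have "\<dots> \<le> (expectation (\<lambda>x. \<bar>g x\<bar>\<^sup>2))\<^sup>2"
    using int[of 1] int[of 2] by (intro power_mono power2_expectation_le) auto
  also have "\<dots> \<le> expectation (\<lambda>x. (\<bar>g x\<bar>\<^sup>2)\<^sup>2)"
    using int[of 2] int[of 4] by (intro power2_expectation_le) auto
  finally show ?thesis by simp
qed

text \<open>Both functions are compared with their common second-order Taylor polynomial
  \<open>1 - t\<^sup>2 / 2\<close>; the third moment pays for the first comparison and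
  \<open>t ^ 4\<close> for the second.\<close>

lemma char_approx_normal:
  fixes X :: "'a \<Rightarrow> real"
  assumes [measurable]: "random_variable borel X"
    and int: "integrable M X" "integrable M (\<lambda>x. (X x)\<^sup>2)" "integrable M (\<lambda>x. \<bar>X x\<bar> ^ 3)"
    and mom: "expectation X = 0" "expectation (\<lambda>x. (X x)\<^sup>2) = 1"
  shows "cmod (char (distr M borel X) t - exp (- (t\<^sup>2 / 2)))
    \<le> expectation (\<lambda>x. \<bar>X x\<bar> ^ 3) * \<bar>t\<bar> ^ 3 + t ^ 4"
proof -
  have "cmod (char (distr M borel X) t - (1 - t\<^sup>2 * 1 / 2)) \<le>
    (t\<^sup>2 / 6) * expectation (\<lambda>x. min (6 * (X x)^2) (\<bar>t\<bar> * \<bar>X x\<bar>^3))"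
    using int mom by (intro char_approx3') auto
  also have "\<dots> \<le> t\<^sup>2 / 6 * expectation (\<lambda>x. \<bar>t\<bar> * \<bar>X x\<bar>^3)"
    using int by (intro mult_left_mono integral_mono integrable_min) auto
  also have "\<dots> = (expectation (\<lambda>x. \<bar>X x\<bar> ^ 3) * \<bar>t\<bar> ^ 3) / 6"
    by (simp add: power2_eq_square power3_eq_cube algebra_simps)
  also have "\<dots> \<le> expectation (\<lambda>x. \<bar>X x\<bar> ^ 3) * \<bar>t\<bar> ^ 3" by simp
  finally have 1: "cmod (char (distr M borel X) t - (1 - t\<^sup>2 / 2)) \<le> expectation (\<lambda>x. \<bar>X x\<bar> ^ 3) * \<bar>t\<bar> ^ 3"
    by simp
  have "\<bar>exp (- (t\<^sup>2 / 2)) - (1 - t\<^sup>2 / 2)\<bar> \<le> (t\<^sup>2 / 2)\<^sup>2 / 2"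
    by (rule abs_exp_minus_Taylor_le) simp
  also have "\<dots> = t ^ 4 / 8" by (simp add: power_divide)
  also have "\<dots> \<le> t ^ 4" by simp
  finally have "cmod (complex_of_real ((1 - t\<^sup>2 / 2) - exp (- (t\<^sup>2 / 2)))) \<le> t ^ 4"
    by (simp only: norm_of_real abs_minus_commute)
  then have 2: "cmod ((1 - t\<^sup>2 / 2) - exp (- (t\<^sup>2 / 2))) \<le> t ^ 4"
    by simp
  show ?thesis
    using norm_triangle_ineq[of "char (distr M borel X) t - (1 - t\<^sup>2 / 2)" "(1 - t\<^sup>2 / 2) - exp (- (t\<^sup>2 / 2))"] 1 2
    by simp
qed

text \<open>Independence turns the left term into a product, and the Gaussian splits into a product
  as well. All factors have modulus at most 1, so exchanging them one at a time costs no more than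
  the sum of the individual errors.\<close>

lemma sum_independent_char_approx_normal:
  fixes U :: "'i \<Rightarrow> 'a \<Rightarrow> real" and t :: "'i \<Rightarrow> real"
  assumes fin: "finite I" and indep: "indep_vars (\<lambda>_. borel) U I"
    and int: "\<And>i. i \<in> I \<Longrightarrow> integrable M (U i)" "\<And>i. i \<in> I \<Longrightarrow> integrable M (\<lambda>x. (U i x)\<^sup>2)"
      "\<And>i. i \<in> I \<Longrightarrow> integrable M (\<lambda>x. \<bar>U i x\<bar> ^ 3)"
    and mom: "\<And>i. i \<in> I \<Longrightarrow> expectation (U i) = 0" "\<And>i. i \<in> I \<Longrightarrow> expectation (\<lambda>x. (U i x)\<^sup>2) = 1"
      "\<And>i. i \<in> I \<Longrightarrow> expectation (\<lambda>x. \<bar>U i x\<bar> ^ 3) \<le> \<kappa>"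
  shows "cmod (expectation (\<lambda>x. iexp (\<Sum>i\<in>I. t i * U i x)) - exp (- ((\<Sum>i\<in>I. (t i)\<^sup>2) / 2)))
    \<le> (\<Sum>i\<in>I. \<kappa> * \<bar>t i\<bar> ^ 3 + t i ^ 4)"
proof -
  have [measurable]: "U i \<in> borel_measurable M" if "i \<in> I" for i
    using indep that unfolding indep_vars_def by auto
  have indep': "indep_vars (\<lambda>_. borel) (\<lambda>i x. t i * U i x) I"
    using indep_vars_compose2[OF indep, of "\<lambda>i x. t i * x" "\<lambda>_. borel"] by simp
  have c: "char (distr M borel (\<lambda>x. t i * U i x)) 1 = char (distr M borel (U i)) (t i)" if "i \<in> I" for i
    using that by (simp add: char_def integral_distr)
  have "expectation (\<lambda>x. iexp (\<Sum>i\<in>I. t i * U i x))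
      = char (distr M borel (\<lambda>x. \<Sum>i\<in>I. t i * U i x)) 1"
    by (simp add: char_def integral_distr)
  also have "\<dots> = (\<Prod>i\<in>I. char (distr M borel (U i)) (t i))"
    by (subst char_distr_sum[OF indep']) (simp add: c)
  finally have 1: "expectation (\<lambda>x. iexp (\<Sum>i\<in>I. t i * U i x)) = (\<Prod>i\<in>I. char (distr M borel (U i)) (t i))" .
  have 2: "exp (- ((\<Sum>i\<in>I. (t i)\<^sup>2) / 2)) = (\<Prod>i\<in>I. exp (- ((t i)\<^sup>2 / 2)))"
    using fin by (simp flip: exp_sum add: sum_negf sum_divide_distrib)
  have "cmod ((\<Prod>i\<in>I. char (distr M borel (U i)) (t i)) - (\<Prod>i\<in>I. complex_of_real (exp (- ((t i)\<^sup>2 / 2)))))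
     \<le> (\<Sum>i\<in>I. cmod (char (distr M borel (U i)) (t i) - complex_of_real (exp (- ((t i)\<^sup>2 / 2)))))"
    by (intro norm_prod_diff real_distribution.cmod_char_le_1 real_distribution_distr) auto
  also have "\<dots> \<le> (\<Sum>i\<in>I. \<kappa> * \<bar>t i\<bar> ^ 3 + t i ^ 4)"
  proof (rule sum_mono)
    fix i assume i: "i \<in> I"
    have "cmod (char (distr M borel (U i)) (t i) - complex_of_real (exp (- ((t i)\<^sup>2 / 2))))
      \<le> expectation (\<lambda>x. \<bar>U i x\<bar> ^ 3) * \<bar>t i\<bar> ^ 3 + t i ^ 4"
      using i int mom by (intro char_approx_normal) auto
    also have "\<dots> \<le> \<kappa> * \<bar>t i\<bar> ^ 3 + t i ^ 4"
      using mom(3)[OF i] by (intro add_right_mono mult_right_mono) auto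
    finally show "cmod (char (distr M borel (U i)) (t i) - complex_of_real (exp (- ((t i)\<^sup>2 / 2)))) \<le> \<dots>" .
  qed
  finally show ?thesis
    unfolding 1 2 by simp
qed

text \<open>Mean and variance travel through the induction because expanding the fourth power of
  \<open>U j + S\<close> needs them: the terms with an odd power of a centered factor vanish by
  independence, and the mixed square term needs the variance of the partial sum.\<close>

lemma fourth_moment_sum_le:
  fixes U :: "'i \<Rightarrow> 'a \<Rightarrow> real"
  assumes "finite I" "indep_vars (\<lambda>_. borel) U I"
    and "\<And>i. i \<in> I \<Longrightarrow> integrable M (\<lambda>x. (U i x) ^ 4)"
    and "\<And>i. i \<in> I \<Longrightarrow> expectation (U i) = 0"
      "\<And>i. i \<in> I \<Longrightarrow> expectation (\<lambda>x. (U i x) ^ 4) \<le> \<kappa>"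
    and "\<And>i. i \<in> I \<Longrightarrow> expectation (\<lambda>x. (U i x)\<^sup>2) \<le> 1"
    and \<kappa>: "1 \<le> \<kappa>"
  shows "integrable M (\<lambda>x. (\<Sum>i\<in>I. U i x) ^ 4) \<and> expectation (\<lambda>x. \<Sum>i\<in>I. U i x) = 0
    \<and> expectation (\<lambda>x. (\<Sum>i\<in>I. U i x)\<^sup>2) \<le> card I
    \<and> expectation (\<lambda>x. (\<Sum>i\<in>I. U i x) ^ 4) \<le> 3 * \<kappa> * (card I)\<^sup>2"
  using assms(1-6)
proof (induction I rule: finite_induct)
  case empty
  then show ?case by simp
next
  case (insert j F)
  define S where "S x = (\<Sum>i\<in>F. U i x)" for x
  have indF: "indep_vars (\<lambda>_. borel) U F"
    using insert.prems(1) by (rule indep_vars_subset) auto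
  have IH: "integrable M (\<lambda>x. S x ^ 4)" "expectation S = 0"
      "expectation (\<lambda>x. (S x)\<^sup>2) \<le> card F" "expectation (\<lambda>x. S x ^ 4) \<le> 3 * \<kappa> * (card F)\<^sup>2"
    using insert.IH[OF indF] insert.prems by (auto simp: S_def[abs_def])
  have iv: "indep_var borel (U j) borel S"
    unfolding S_def by (rule indep_vars_sum[OF insert(1,2) insert.prems(1)])
  have m[measurable]: "U j \<in> borel_measurable M" "S \<in> borel_measurable M"
    using indep_var_rv1[OF iv] indep_var_rv2[OF iv] by auto
  have iU4: "integrable M (\<lambda>x. U j x ^ 4)" using insert.prems by auto
  have prod: "integrable M (\<lambda>x. U j x ^ k * S x ^ l) \<and>
      expectation (\<lambda>x. U j x ^ k * S x ^ l) = expectation (\<lambda>x. U j x ^ k) * expectation (\<lambda>x. S x ^ l)"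
    if "k \<le> 4" "l \<le> 4" for k l
  proof -
    have "indep_var borel ((\<lambda>y. y ^ k) \<circ> U j) borel ((\<lambda>y. y ^ l) \<circ> S)"
      by (rule indep_var_compose[OF iv]) auto
    then have "indep_var borel (\<lambda>x. U j x ^ k) borel (\<lambda>x. S x ^ l)" by (simp add: comp_def)
    from indep_var_integrable[OF this integrable_power_le4[OF iU4 that(1) m(1)] integrable_power_le4[OF IH(1) that(2) m(2)]]
      indep_var_lebesgue_integral[OF this integrable_power_le4[OF iU4 that(1) m(1)] integrable_power_le4[OF IH(1) that(2) m(2)]]
    show ?thesis by simp
  qed
  have sum: "(\<Sum>i\<in>insert j F. U i x) = U j x + S x" for x
    using insert(1,2) by (simp add: S_def)
  have card: "card (insert j F) = card F + 1" using insert(1,2) by simp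
  have e4: "(U j x + S x) ^ 4 = U j x ^ 4 + 4 * (U j x ^ 3 * S x ^ 1) + 6 * (U j x ^ 2 * S x ^ 2)
       + 4 * (U j x ^ 1 * S x ^ 3) + S x ^ 4" for x
    by (simp add: power2_eq_square power3_eq_cube power4_eq_xxxx algebra_simps)
  have e2: "(U j x + S x) ^ 2 = U j x ^ 2 + 2 * (U j x ^ 1 * S x ^ 1) + S x ^ 2" for x
    by (simp add: power2_eq_square algebra_simps)
  have EU: "expectation (U j) = 0" "expectation (\<lambda>x. U j x ^ 4) \<le> \<kappa>" "expectation (\<lambda>x. (U j x)\<^sup>2) \<le> 1"
    using insert.prems by auto
  have p31: "integrable M (\<lambda>x. U j x ^ 3 * S x ^ 1)" "expectation (\<lambda>x. U j x ^ 3 * S x ^ 1) = 0"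
    and p13: "integrable M (\<lambda>x. U j x ^ 1 * S x ^ 3)" "expectation (\<lambda>x. U j x ^ 1 * S x ^ 3) = 0"
    and p11: "integrable M (\<lambda>x. U j x ^ 1 * S x ^ 1)" "expectation (\<lambda>x. U j x ^ 1 * S x ^ 1) = 0"
    and p22: "integrable M (\<lambda>x. U j x ^ 2 * S x ^ 2)"
     "expectation (\<lambda>x. U j x ^ 2 * S x ^ 2) = expectation (\<lambda>x. U j x ^ 2) * expectation (\<lambda>x. S x ^ 2)"
    using prod[of 3 1] prod[of 1 3] prod[of 1 1] prod[of 2 2] EU(1) IH(2) by simp_all
  have i2: "integrable M (\<lambda>x. U j x ^ 2)" "integrable M (\<lambda>x. S x ^ 2)"
    using integrable_power_le4[OF iU4 _ m(1), of 2] integrable_power_le4[OF IH(1) _ m(2), of 2] by auto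
  have I1: "integrable M (U j)" "integrable M S"
    using integrable_power_le4[OF iU4 _ m(1), of 1] integrable_power_le4[OF IH(1) _ m(2), of 1] by auto
  have "integrable M (\<lambda>x. (U j x + S x) ^ 4)"
    unfolding e4 by (intro Bochner_Integration.integrable_add integrable_mult_right iU4 IH(1) p31 p13 p22)
  moreover have "expectation (\<lambda>x. U j x + S x) = 0"
    using I1 EU(1) IH(2) by simp
  moreover have "expectation (\<lambda>x. (U j x + S x)\<^sup>2) \<le> card F + 1"
  proof -
    have "expectation (\<lambda>x. (U j x + S x)\<^sup>2) = expectation (\<lambda>x. U j x ^ 2) + expectation (\<lambda>x. S x ^ 2)"
      unfolding e2 using p11 i2 by simp
    then show ?thesis using EU(3) IH(3) by simp
  qed
  moreover have "expectation (\<lambda>x. (U j x + S x) ^ 4) \<le> 3 * \<kappa> * (card F + 1)\<^sup>2"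
  proof -
    have "expectation (\<lambda>x. (U j x + S x) ^ 4) = expectation (\<lambda>x. U j x ^ 4)
        + 6 * (expectation (\<lambda>x. U j x ^ 2) * expectation (\<lambda>x. S x ^ 2)) + expectation (\<lambda>x. S x ^ 4)"
      unfolding e4 using iU4 IH(1) p31 p13 p22 by simp
    also have "\<dots> \<le> \<kappa> + 6 * (1 * real (card F)) + 3 * \<kappa> * (card F)\<^sup>2"
      by (intro add_mono mult_left_mono mult_mono EU IH integral_nonneg_AE AE_I2) auto
    \<comment> \<open>Inflating the first two terms, by means of \<open>1 \<le> \<kappa>\<close>,
      completes the square in \<open>card F + 1\<close>.\<close>
    also have "\<dots> \<le> 3 * \<kappa> + 6 * (\<kappa> * card F) + 3 * \<kappa> * (card F)\<^sup>2"
      using \<kappa> by (intro add_mono mult_left_mono mult_right_mono) auto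
    also have "\<dots> = 3 * \<kappa> * (card F + 1)\<^sup>2"
      by (simp add: power2_eq_square algebra_simps)
    finally show ?thesis .
  qed
  ultimately show ?case
    unfolding sum card by simp
qed

end

subsection \<open>Fourier decay and the Dirichlet mean\<close>

lemma card_near_le:
  fixes k n :: nat and s :: real
  assumes "1 \<le> s"
  shows "real (card {l \<in> {1..n}. \<bar>real k - real l\<bar> \<le> s}) \<le> 3 * s"
proof -
  have "int ` {l \<in> {1..n}. \<bar>real k - real l\<bar> \<le> s} \<subseteq> {int k - \<lfloor>s\<rfloor> .. int k + \<lfloor>s\<rfloor>}"
  proof clarify
    fix l assume "\<bar>real k - real l\<bar> \<le> s"
    then have "\<bar>int k - int l\<bar> \<le> \<lfloor>s\<rfloor>" by (simp add: le_floor_iff)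
    then show "int l \<in> {int k - \<lfloor>s\<rfloor> .. int k + \<lfloor>s\<rfloor>}" by auto
  qed
  then have "card (int ` {l \<in> {1..n}. \<bar>real k - real l\<bar> \<le> s}) \<le> card {int k - \<lfloor>s\<rfloor> .. int k + \<lfloor>s\<rfloor>}"
    by (intro card_mono) auto
  also have "card (int ` {l \<in> {1..n}. \<bar>real k - real l\<bar> \<le> s}) = card {l \<in> {1..n}. \<bar>real k - real l\<bar> \<le> s}"
    by (intro card_image) (auto simp: inj_on_def)
  finally have "int (card {l \<in> {1..n}. \<bar>real k - real l\<bar> \<le> s}) \<le> 2 * \<lfloor>s\<rfloor> + 1"
    using assms zero_le_floor[of s] by (simp add: le_nat_iff del: zero_le_floor)
  then have "real (card {l \<in> {1..n}. \<bar>real k - real l\<bar> \<le> s}) \<le> 2 * of_int \<lfloor>s\<rfloor> + 1"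
    by (simp add: of_int_le_iff[where ?'a=real, symmetric] del: of_int_le_iff)
  also have "\<dots> \<le> 3 * s"
    using assms of_int_floor_le[of s] by linarith
  finally show ?thesis .
qed

text \<open>The covariance of the normalized random sum at two points whose difference is
  \<open>u\<close>; up to normalization, a Dirichlet kernel without its constant term.\<close>

definition dirichlet_mean :: "nat \<Rightarrow> real \<Rightarrow> real"
  where "dirichlet_mean n u = (\<Sum>k=1..n. cos (real k * u)) / real n"

lemma dirichlet_mean_measurable [measurable]: "dirichlet_mean n \<in> borel_measurable borel"
  unfolding dirichlet_mean_def by measurable

lemma abs_dirichlet_mean_le: "\<bar>dirichlet_mean n u\<bar> \<le> 1"
proof -
  have "\<bar>\<Sum>k=1..n. cos (real k * u)\<bar> \<le> (\<Sum>k=1..n. 1)"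
    by (rule order_trans[OF sum_abs]) (intro sum_mono, simp)
  then show ?thesis by (simp add: dirichlet_mean_def divide_le_eq)
qed

text \<open>Adding the square of the sine sum makes the expression depend on \<open>k - l\<close>
  only. Its mean over two copies of the random point is then made of squared Fourier
  coefficients.\<close>

lemma dirichlet_mean_square_le:
  "(dirichlet_mean n u)\<^sup>2 \<le> (\<Sum>k=1..n. \<Sum>l=1..n. cos ((real k - real l) * u)) / (real n)\<^sup>2"
proof -
  have "(\<Sum>k=1..n. cos (real k * u))\<^sup>2 \<le> (\<Sum>k=1..n. cos (real k * u))\<^sup>2 + (\<Sum>k=1..n. sin (real k * u))\<^sup>2"
    by simp
  also have "\<dots> = (\<Sum>k=1..n. \<Sum>l=1..n. cos ((real k - real l) * u))"
    unfolding power2_eq_square sum_product sum.distrib[symmetric] left_diff_distrib cos_diff ..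
  finally show ?thesis
    by (simp add: dirichlet_mean_def power_divide divide_right_mono)
qed

context real_distribution
begin

lemma integral_pair_mult_cnj:
  fixes H :: "real \<Rightarrow> complex"
  assumes [measurable]: "H \<in> borel_measurable borel" and B: "\<And>x. cmod (H x) \<le> B"
  shows "integrable (M \<Otimes>\<^sub>M M) (\<lambda>z. H (fst z) * cnj (H (snd z)))"
    and "(\<integral>z. H (fst z) * cnj (H (snd z)) \<partial>(M \<Otimes>\<^sub>M M)) = (\<integral>x. H x \<partial>M) * cnj (\<integral>x. H x \<partial>M)"
proof -
  interpret PP: pair_prob_space M M ..
  have [measurable]: "cnj \<in> borel_measurable borel"
    by (intro borel_measurable_continuous_onI) (auto intro!: continuous_intros)
  have B0: "0 \<le> B" using B[of 0] norm_ge_zero order_trans by blast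
  show int: "integrable (M \<Otimes>\<^sub>M M) (\<lambda>z. H (fst z) * cnj (H (snd z)))"
    by (rule PP.P.integrable_const_bound[of _ "B * B"])
       (auto simp: norm_mult intro!: mult_mono B B0)
  have intH: "integrable M H"
    by (rule integrable_const_bound[of _ B]) (auto intro: B)
  show "(\<integral>z. H (fst z) * cnj (H (snd z)) \<partial>(M \<Otimes>\<^sub>M M)) = (\<integral>x. H x \<partial>M) * cnj (\<integral>x. H x \<partial>M)"
    by (subst PP.integral_fst'[OF int, symmetric]) (simp add: intH)
qed

lemma integral_pair_cos_diff:
  "integrable (M \<Otimes>\<^sub>M M) (\<lambda>z. cos (r * (fst z - snd z)))"
  "(\<integral>z. cos (r * (fst z - snd z)) \<partial>(M \<Otimes>\<^sub>M M)) = (cmod (char M r))\<^sup>2"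
proof -
  have eq: "cos (r * (fst z - snd z)) = Re (iexp (r * fst z) * cnj (iexp (r * snd z)))" for z
    by (simp add: exp_Euler[symmetric] exp_cnj cos_diff right_diff_distrib Re_exp Im_exp)
  have i: "integrable (M \<Otimes>\<^sub>M M) (\<lambda>z. iexp (r * fst z) * cnj (iexp (r * snd z)))"
    by (rule integral_pair_mult_cnj[of "\<lambda>x. iexp (r * x)" 1]) auto
  have e: "(\<integral>z. iexp (r * fst z) * cnj (iexp (r * snd z)) \<partial>(M \<Otimes>\<^sub>M M)) = char M r * cnj (char M r)"
    unfolding char_def by (rule integral_pair_mult_cnj[of "\<lambda>x. iexp (r * x)" 1]) auto
  show "integrable (M \<Otimes>\<^sub>M M) (\<lambda>z. cos (r * (fst z - snd z)))"
    unfolding eq by (rule integrable_Re[OF i])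
  have "(\<integral>z. cos (r * (fst z - snd z)) \<partial>(M \<Otimes>\<^sub>M M)) = Re (char M r * cnj (char M r))"
    unfolding eq integral_Re[OF i] e ..
  also have "\<dots> = (cmod (char M r))\<^sup>2"
    by (simp only: complex_norm_square[symmetric] Re_complex_of_real)
  finally show "(\<integral>z. cos (r * (fst z - snd z)) \<partial>(M \<Otimes>\<^sub>M M)) = (cmod (char M r))\<^sup>2" .
qed

text \<open>Jensen reduces the claim to the mean square, which is at most the average of
  \<open>(cmod (char M (k - l)))\<^sup>2\<close> over all pairs of frequencies. Pairs within
  distance \<open>sqrt n\<close> are bounded by 1 and number at most \<open>3 * sqrt n\<close> per
  row; for the others the decay gives C^2 n^(-\<alpha>). The square root of n^(-1/2) + n^(-\<alpha>)
  accounts for the exponent.\<close>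

lemma integral_dirichlet_mean_le:
  fixes \<alpha> C :: real
  assumes decay: "\<And>k::int. k \<noteq> 0 \<Longrightarrow> cmod (char M (of_int k)) \<le> C / \<bar>of_int k\<bar> powr \<alpha>"
    and "0 < \<alpha>" "0 \<le> C" and n: "1 \<le> n"
  shows "(\<integral>z. \<bar>dirichlet_mean n (fst z - snd z)\<bar> \<partial>(M \<Otimes>\<^sub>M M))
    \<le> (3 + C\<^sup>2) * real n powr - min (1/4) (\<alpha>/2)"
proof -
  interpret PP: pair_prob_space M M ..
  define \<delta> where "\<delta> = min (1/4) (\<alpha>/2)"
  have n1: "1 \<le> real n" using n by simp
  have sq: "1 \<le> sqrt (real n)" using n1 by simp
  have row: "(\<Sum>l=1..n. (cmod (char M (real k - real l)))\<^sup>2) \<le> 3 * sqrt (real n) + real n * (C\<^sup>2 * real n powr - \<alpha>)"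
    for k :: nat
  proof -
    have "(cmod (char M (real k - real l)))\<^sup>2
        \<le> (if \<bar>real k - real l\<bar> \<le> sqrt (real n) then 1 else 0) + C\<^sup>2 * real n powr - \<alpha>" for l :: nat
    proof (cases "\<bar>real k - real l\<bar> \<le> sqrt (real n)")
      case True
      have "(cmod (char M (real k - real l)))\<^sup>2 \<le> 1" by (simp add: power_le_one cmod_char_le_1)
      then show ?thesis using True by (simp add: add_increasing2)
    next
      case False
      then have "int k - int l \<noteq> 0" using sq by auto
      from decay[OF this] have "cmod (char M (real k - real l)) \<le> C / \<bar>real k - real l\<bar> powr \<alpha>"
        by simp
      also have "\<dots> \<le> C / sqrt (real n) powr \<alpha>"
        using False sq assms by (intro divide_left_mono powr_mono2 mult_pos_pos) auto
      finally have "(cmod (char M (real k - real l)))\<^sup>2 \<le> (C / sqrt (real n) powr \<alpha>)\<^sup>2"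
        by (intro power_mono) auto
      also have "\<dots> = C\<^sup>2 * real n powr - \<alpha>"
        using n1 by (simp add: power_divide powr_minus divide_simps powr_half_sqrt[symmetric] powr_powr
           flip: powr_realpow powr_numeral)
      finally show ?thesis using False by simp
    qed
    then have "(\<Sum>l=1..n. (cmod (char M (real k - real l)))\<^sup>2)
       \<le> (\<Sum>l=1..n. (if \<bar>real k - real l\<bar> \<le> sqrt (real n) then 1 else 0) + C\<^sup>2 * real n powr - \<alpha>)"
      by (intro sum_mono) auto
    also have "\<dots> = real (card {l \<in> {1..n}. \<bar>real k - real l\<bar> \<le> sqrt (real n)}) + real n * (C\<^sup>2 * real n powr - \<alpha>)"
      by (simp add: sum.distrib sum.If_cases Int_def)
    also have "\<dots> \<le> 3 * sqrt (real n) + real n * (C\<^sup>2 * real n powr - \<alpha>)"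
      by (intro add_right_mono card_near_le sq)
    finally show ?thesis .
  qed
  let ?D = "\<lambda>z. dirichlet_mean n (fst z - snd z)"
  have [measurable]: "?D \<in> borel_measurable (M \<Otimes>\<^sub>M M)" by measurable
  have intD: "integrable (M \<Otimes>\<^sub>M M) (\<lambda>z. \<bar>?D z\<bar>)"
    by (rule PP.P.integrable_const_bound[of _ 1]) (auto simp: abs_dirichlet_mean_le)
  have intD2: "integrable (M \<Otimes>\<^sub>M M) (\<lambda>z. \<bar>?D z\<bar>\<^sup>2)"
    by (rule PP.P.integrable_const_bound[of _ 1]) (auto simp: abs_square_le_1 abs_dirichlet_mean_le)
  have "(\<integral>z. \<bar>?D z\<bar> \<partial>(M \<Otimes>\<^sub>M M))\<^sup>2 \<le> (\<integral>z. \<bar>?D z\<bar>\<^sup>2 \<partial>(M \<Otimes>\<^sub>M M))"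
    by (rule PP.P.power2_expectation_le[OF intD intD2])
  also have "\<dots> \<le> (\<integral>z. (\<Sum>k=1..n. \<Sum>l=1..n. cos ((real k - real l) * (fst z - snd z))) / (real n)\<^sup>2 \<partial>(M \<Otimes>\<^sub>M M))"
    by (intro integral_mono intD2 integrable_divide Bochner_Integration.integrable_sum integral_pair_cos_diff)
       (simp only: power2_abs dirichlet_mean_square_le)
  also have "\<dots> = (\<Sum>k=1..n. \<Sum>l=1..n. (cmod (char M (real k - real l)))\<^sup>2) / (real n)\<^sup>2"
    by (simp add: integral_pair_cos_diff)
  also have "\<dots> \<le> (\<Sum>k=1..n. 3 * sqrt (real n) + real n * (C\<^sup>2 * real n powr - \<alpha>)) / (real n)\<^sup>2"
    by (intro divide_right_mono sum_mono row) auto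
  also have "\<dots> = 3 * real n powr (- (1/2)) + C\<^sup>2 * real n powr - \<alpha>"
  proof -
    have "sqrt (real n) / real n = real n powr (- (1/2))"
      using n1 by (simp add: powr_minus powr_half_sqrt real_div_sqrt field_simps)
    then show ?thesis
      using n1 by (simp add: power2_eq_square field_simps)
  qed
  also have "\<dots> \<le> 3 * real n powr (- 2 * \<delta>) + C\<^sup>2 * real n powr (- 2 * \<delta>)"
    using n1 by (intro add_mono mult_left_mono powr_mono) (auto simp: \<delta>_def min_def)
  also have "\<dots> = (3 + C\<^sup>2) * (real n powr - \<delta>)\<^sup>2"
    using n1 by (simp add: algebra_simps powr_powr mult.commute flip: powr_realpow powr_numeral)
  \<comment> \<open>Squaring a constant that is at least 1 turns the bound into a perfect square, so
    that the root can be taken without a \<open>sqrt\<close> in the constant.\<close>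
  also have "\<dots> \<le> (3 + C\<^sup>2)\<^sup>2 * (real n powr - \<delta>)\<^sup>2"
    by (intro mult_right_mono) (auto intro!: self_le_power simp: add_increasing2)
  also have "\<dots> = ((3 + C\<^sup>2) * real n powr - \<delta>)\<^sup>2"
    by (simp add: power_mult_distrib)
  finally show ?thesis
    unfolding \<delta>_def by (rule power2_le_imp_le) auto
qed

end

subsection \<open>Random trigonometric sums\<close>

text \<open>One index set for both families, in the encoding of the joint independence hypothesis:
  \<open>Inl k\<close> goes with the cosine coefficient, \<open>Inr k\<close> with the sine
  coefficient.\<close>

definition trig :: "nat + nat \<Rightarrow> real \<Rightarrow> real"
  where "trig i t = (case i of Inl k \<Rightarrow> cos (real k * t) | Inr k \<Rightarrow> sin (real k * t))"

lemma trig_measurable [measurable]: "trig i \<in> borel_measurable borel"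
  unfolding trig_def by (cases i) auto

lemma abs_trig_le: "\<bar>trig i t\<bar> \<le> 1"
  by (cases i) (auto simp: trig_def)

text \<open>Half-open blocks, so that adjacent ones are disjoint and concatenate without index
  shifts.\<close>

abbreviation freqs :: "nat \<Rightarrow> nat \<Rightarrow> (nat + nat) set"
  where "freqs m n \<equiv> {m<..n} <+> {m<..n}"

lemma card_freqs: "card (freqs m n) = 2 * (n - m)"
  by (simp add: card_Plus)

lemma sum_trig_square: "(\<Sum>i\<in>freqs 0 n. (trig i x)\<^sup>2) = real n"
  by (simp add: sum.Plus trig_def flip: sum.distrib)

lemma sum_trig_diff_square:
  "(\<Sum>i\<in>freqs 0 n. (trig i x - trig i y)\<^sup>2) = 2 * real n * (1 - dirichlet_mean n (x - y))"
proof -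
  have "(\<Sum>i\<in>freqs 0 n. (trig i x - trig i y)\<^sup>2)
      = (\<Sum>k\<in>{0<..n}. (cos (real k * x) - cos (real k * y))\<^sup>2 + (sin (real k * x) - sin (real k * y))\<^sup>2)"
    by (simp add: sum.Plus trig_def sum.distrib)
  also have "\<dots> = (\<Sum>k\<in>{0<..n}. 2 - 2 * cos (real k * (x - y)))"
  proof (rule sum.cong[OF refl])
    fix k
    have id: "(c - d)\<^sup>2 + (s - r)\<^sup>2 = (s\<^sup>2 + c\<^sup>2) + (r\<^sup>2 + d\<^sup>2) - 2 * (c * d + s * r)" for c d s r :: real
      by (simp add: power2_eq_square algebra_simps)
    show "(cos (real k * x) - cos (real k * y))\<^sup>2 + (sin (real k * x) - sin (real k * y))\<^sup>2
        = 2 - 2 * cos (real k * (x - y))"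
      unfolding id sin_cos_squared_add right_diff_distrib cos_diff by simp
  qed
  also have "\<dots> = 2 * real n - 2 * (\<Sum>k\<in>{0<..n}. cos (real k * (x - y)))"
    by (simp add: sum_subtractf sum_distrib_left)
  also have "(\<Sum>k\<in>{0<..n}. cos (real k * (x - y))) = real n * dirichlet_mean n (x - y)"
    by (simp add: dirichlet_mean_def atLeastSucAtMost_greaterThanAtMost)
  finally show ?thesis
    by (simp add: right_diff_distrib)
qed

text \<open>\<open>P\<close> stands for the law of the random point. The common law of the
  coefficients enters through uniform moment data, with \<open>\<kappa>\<close> also absorbing
  numerical constants.\<close>

locale random_trig_sum = M: prob_space M + P: real_distribution P
  for M :: "'a measure" and P :: "real measure" +
  fixes U :: "nat + nat \<Rightarrow> 'a \<Rightarrow> real" and \<kappa> :: real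
  assumes indep: "M.indep_vars (\<lambda>_. borel) U ({1..} <+> {1..})"
    and integrable4: "\<And>i. i \<in> {1..} <+> {1..} \<Longrightarrow> integrable M (\<lambda>\<omega>. U i \<omega> ^ 4)"
    and centered: "\<And>i. i \<in> {1..} <+> {1..} \<Longrightarrow> M.expectation (U i) = 0"
    and unit_variance: "\<And>i. i \<in> {1..} <+> {1..} \<Longrightarrow> M.expectation (\<lambda>\<omega>. (U i \<omega>)\<^sup>2) = 1"
    and fourth_moment: "\<And>i. i \<in> {1..} <+> {1..} \<Longrightarrow> M.expectation (\<lambda>\<omega>. U i \<omega> ^ 4) \<le> \<kappa>"
    and kappa: "1 \<le> \<kappa>"
begin

sublocale MP: pair_prob_space M P ..
sublocale PP: pair_prob_space P P ..
sublocale MPP: pair_prob_space M "P \<Otimes>\<^sub>M P" ..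

lemma freqs_subset: "freqs m n \<subseteq> {1..} <+> {1..}"
  by auto

lemma U_measurable: "i \<in> freqs m n \<Longrightarrow> U i \<in> borel_measurable M"
  using indep freqs_subset[of m n] unfolding M.indep_vars_def by auto

lemma indep_freqs: "M.indep_vars (\<lambda>_. borel) U (freqs m n)"
  by (rule M.indep_vars_subset[OF indep freqs_subset])

definition S :: "nat \<Rightarrow> nat \<Rightarrow> 'a \<Rightarrow> real \<Rightarrow> real"
  where "S m n \<omega> t = (\<Sum>i\<in>freqs m n. trig i t * U i \<omega>)"

definition f :: "nat \<Rightarrow> 'a \<Rightarrow> real \<Rightarrow> real"
  where "f n \<omega> t = S 0 n \<omega> t / sqrt (real n)"

lemma S_measurable [measurable]: "(\<lambda>z. S m n (fst z) (snd z)) \<in> borel_measurable (M \<Otimes>\<^sub>M borel)"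
  unfolding S_def
proof (rule borel_measurable_sum)
  fix i assume "i \<in> freqs m n"
  note U_measurable[OF this, measurable]
  show "(\<lambda>z. trig i (snd z) * U i (fst z)) \<in> borel_measurable (M \<Otimes>\<^sub>M borel)" by measurable
qed

lemma S_measurable' [measurable (raw)]:
  assumes [measurable]: "g \<in> measurable N M" "h \<in> borel_measurable N"
  shows "(\<lambda>x. S m n (g x) (h x)) \<in> borel_measurable N"
  using measurable_compose[OF _ S_measurable, of "\<lambda>x. (g x, h x)" N] by simp

lemma S_measurable_snd [measurable]: "S m n \<omega> \<in> borel_measurable borel"
  unfolding S_def by measurable

lemma f_measurable [measurable (raw)]:
  assumes [measurable]: "g \<in> measurable N M" "h \<in> borel_measurable N"
  shows "(\<lambda>x. f n (g x) (h x)) \<in> borel_measurable N"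
  unfolding f_def by measurable

lemma f_measurable_snd [measurable]: "f n \<omega> \<in> borel_measurable borel"
  unfolding f_def by measurable

lemma S_bounded: "\<bar>S m n \<omega> t\<bar> \<le> (\<Sum>i\<in>freqs m n. \<bar>U i \<omega>\<bar>)"
  unfolding S_def
  by (rule order_trans[OF sum_abs]) (auto intro!: sum_mono mult_left_le_one_le simp: abs_mult abs_trig_le)

lemma S_split: "m \<le> l \<Longrightarrow> l \<le> n \<Longrightarrow> S m n \<omega> t = S m l \<omega> t + S l n \<omega> t"
proof -
  assume "m \<le> l" "l \<le> n"
  then have "{m<..n} = {m<..l} \<union> {l<..n}" by auto
  then have "freqs m n = freqs m l \<union> freqs l n" by auto
  then show ?thesis
    unfolding S_def by (simp only:) (rule sum.union_disjoint, auto)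
qed

lemma S_fourth_moment:
  "integrable M (\<lambda>\<omega>. S m n \<omega> t ^ 4)" "M.expectation (\<lambda>\<omega>. S m n \<omega> t ^ 4) \<le> 12 * \<kappa> * (real n - real m)\<^sup>2"
proof -
  have in_idx: "i \<in> {1..} <+> {1..}" if "i \<in> freqs m n" for i
    using that freqs_subset by blast
  have "M.indep_vars (\<lambda>_. borel) (\<lambda>i \<omega>. trig i t * U i \<omega>) (freqs m n)"
    using M.indep_vars_compose2[OF indep_freqs, where Y = "\<lambda>i x. trig i t * x" and N = "\<lambda>_. borel"] by simp
  then have *: "integrable M (\<lambda>\<omega>. S m n \<omega> t ^ 4) \<and> M.expectation (\<lambda>\<omega>. \<Sum>i\<in>freqs m n. trig i t * U i \<omega>) = 0
    \<and> M.expectation (\<lambda>\<omega>. (\<Sum>i\<in>freqs m n. trig i t * U i \<omega>)\<^sup>2) \<le> card (freqs m n)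
    \<and> M.expectation (\<lambda>\<omega>. S m n \<omega> t ^ 4) \<le> 3 * \<kappa> * (card (freqs m n))\<^sup>2"
    unfolding S_def
  proof (intro M.fourth_moment_sum_le)
    fix i assume i: "i \<in> freqs m n"
    show "M.expectation (\<lambda>x. (trig i t * U i x) ^ 4) \<le> \<kappa>"
    proof -
      have "trig i t ^ 4 \<le> 1" using power_mono[OF abs_trig_le, of i t 4] by simp
      then have "trig i t ^ 4 * M.expectation (\<lambda>x. U i x ^ 4) \<le> 1 * \<kappa>"
        by (intro mult_mono fourth_moment[OF in_idx[OF i]]) (auto intro!: integral_nonneg_AE)
      then show ?thesis by (simp add: power_mult_distrib)
    qed
    show "M.expectation (\<lambda>x. (trig i t * U i x)\<^sup>2) \<le> 1"
      using abs_trig_le[of i t] by (simp add: power_mult_distrib unit_variance[OF in_idx[OF i]] abs_square_le_1)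
  qed (auto simp: power_mult_distrib kappa intro!: integrable4 centered)
  then show "integrable M (\<lambda>\<omega>. S m n \<omega> t ^ 4)" by blast
  have "M.expectation (\<lambda>\<omega>. S m n \<omega> t ^ 4) \<le> 3 * \<kappa> * real ((2 * (n - m))\<^sup>2)"
    using * unfolding card_freqs by blast
  also have "\<dots> = 12 * \<kappa> * (real (n - m))\<^sup>2"
    by (simp add: power_mult_distrib)
  \<comment> \<open>An inequality and not an equation, because \<open>n - m\<close> is truncated:
    for \<open>n < m\<close> the block is empty and the left side is 0.\<close>
  also have "\<dots> \<le> 12 * \<kappa> * (real n - real m)\<^sup>2"
    using kappa by (intro mult_left_mono) (auto simp: abs_le_square_iff[symmetric])
  finally show "M.expectation (\<lambda>\<omega>. S m n \<omega> t ^ 4) \<le> 12 * \<kappa> * (real n - real m)\<^sup>2" .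
qed

text \<open>General weights serve the one-point case (\<open>trig i x\<close>) and the two-point
  case (\<open>trig i x - trig i y\<close>) at once; the latter dictates the bound 2. Each of the
  \<open>2 * n\<close> summands contributes at most 16 \<kappa> from the cubic and 16 from the
  quartic term, times (1 + \<xi>^4) n^(-3/2), which gives the constant 64.\<close>

lemma iexp_weighted_sum_approx:
  fixes w :: "nat + nat \<Rightarrow> real"
  assumes n: "1 \<le> n" and w: "\<And>i. \<bar>w i\<bar> \<le> 2"
  shows "cmod (M.expectation (\<lambda>\<omega>. iexp (\<xi> * ((\<Sum>i\<in>freqs 0 n. w i * U i \<omega>) / sqrt (real n))))
      - exp (- (\<xi>\<^sup>2 * (\<Sum>i\<in>freqs 0 n. (w i)\<^sup>2) / (2 * real n))))
    \<le> 64 * \<kappa> * (1 + \<xi> ^ 4) / sqrt (real n)"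
proof -
  define t where "t i = \<xi> * w i / sqrt (real n)" for i
  have n1: "1 \<le> sqrt (real n)" using n by simp
  have in_idx: "i \<in> {1..} <+> {1..}" if "i \<in> freqs 0 n" for i
    using that freqs_subset by blast
  have third: "integrable M (\<lambda>x. \<bar>U i x\<bar> ^ 3)" "M.expectation (\<lambda>x. \<bar>U i x\<bar> ^ 3) \<le> 2 * \<kappa>" if "i \<in> freqs 0 n" for i
  proof -
    note i = in_idx[OF that] and [measurable] = U_measurable[OF that]
    show int: "integrable M (\<lambda>x. \<bar>U i x\<bar> ^ 3)"
      using M.integrable_power_le4[OF integrable4[OF i], of 3, THEN integrable_abs] by (simp add: power_abs)
    have "M.expectation (\<lambda>x. \<bar>U i x\<bar> ^ 3) \<le> M.expectation (\<lambda>x. 1 + U i x ^ 4)"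
      using int integrable4[OF i] by (intro integral_mono) (auto intro!: power_le_one_plus_power4)
    also have "\<dots> = 1 + M.expectation (\<lambda>x. U i x ^ 4)"
      using integrable4[OF i] by (simp add: M.prob_space)
    also have "\<dots> \<le> 2 * \<kappa>" using fourth_moment[OF i] kappa by simp
    finally show "M.expectation (\<lambda>x. \<bar>U i x\<bar> ^ 3) \<le> 2 * \<kappa>" .
  qed
  have low: "integrable M (\<lambda>x. U i x ^ 2)" "integrable M (U i)" if "i \<in> freqs 0 n" for i
    using M.integrable_power_le4[OF integrable4[OF in_idx[OF that]] _ U_measurable[OF that], of 2]
      M.integrable_power_le4[OF integrable4[OF in_idx[OF that]] _ U_measurable[OF that], of 1] by auto
  have "cmod (M.expectation (\<lambda>\<omega>. iexp (\<Sum>i\<in>freqs 0 n. t i * U i \<omega>)) - exp (- ((\<Sum>i\<in>freqs 0 n. (t i)\<^sup>2) / 2)))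
    \<le> (\<Sum>i\<in>freqs 0 n. (2 * \<kappa>) * \<bar>t i\<bar> ^ 3 + t i ^ 4)"
    by (rule M.sum_independent_char_approx_normal)
       (use low third indep_freqs in_idx centered unit_variance in auto)
  also have "\<dots> \<le> (\<Sum>i\<in>freqs 0 n. 32 * \<kappa> * (1 + \<xi> ^ 4) / (sqrt (real n)) ^ 3)"
  proof (rule sum_mono)
    fix i
    have t: "\<bar>t i\<bar> \<le> 2 * \<bar>\<xi>\<bar> / sqrt (real n)"
      using mult_left_mono[OF w[of i], of "\<bar>\<xi>\<bar>"] n1 by (simp add: t_def abs_mult divide_right_mono mult.commute)
    have p3: "\<bar>t i\<bar> ^ 3 \<le> 8 * \<bar>\<xi>\<bar> ^ 3 / sqrt (real n) ^ 3"
      using power_mono[OF t, of 3] by (simp add: power_divide power_mult_distrib)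
    have "t i ^ 4 \<le> 16 * \<xi> ^ 4 / sqrt (real n) ^ 4"
      using power_mono[OF t, of 4] by (simp add: power_divide power_mult_distrib)
    also have "\<dots> \<le> 16 * \<xi> ^ 4 / sqrt (real n) ^ 3"
      using n1 by (intro divide_left_mono power_increasing) auto
    finally have p4: "t i ^ 4 \<le> 16 * \<xi> ^ 4 / sqrt (real n) ^ 3" .
    have "(2 * \<kappa>) * \<bar>t i\<bar> ^ 3 + t i ^ 4 \<le> (2 * \<kappa>) * (8 * \<bar>\<xi>\<bar> ^ 3 / sqrt (real n) ^ 3) + 16 * \<xi> ^ 4 / sqrt (real n) ^ 3"
      using kappa by (intro add_mono mult_left_mono p3 p4) auto
    also have "\<dots> = (16 * \<kappa> * \<bar>\<xi>\<bar> ^ 3 + 16 * \<xi> ^ 4) / sqrt (real n) ^ 3"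
      by (simp add: add_divide_distrib)
    also have "\<dots> \<le> (16 * \<kappa> * (1 + \<xi> ^ 4) + 16 * \<kappa> * (1 + \<xi> ^ 4)) / sqrt (real n) ^ 3"
    proof (intro divide_right_mono add_mono)
      show "16 * \<kappa> * \<bar>\<xi>\<bar> ^ 3 \<le> 16 * \<kappa> * (1 + \<xi> ^ 4)"
        using kappa by (intro mult_left_mono power_le_one_plus_power4) auto
      have "16 * 1 * \<xi> ^ 4 \<le> 16 * \<kappa> * (1 + \<xi> ^ 4)"
        using kappa by (intro mult_mono) auto
      then show "16 * \<xi> ^ 4 \<le> 16 * \<kappa> * (1 + \<xi> ^ 4)" by simp
    qed simp
    finally show "(2 * \<kappa>) * \<bar>t i\<bar> ^ 3 + t i ^ 4 \<le> 32 * \<kappa> * (1 + \<xi> ^ 4) / (sqrt (real n)) ^ 3"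
      by simp
  qed
  also have "\<dots> = 64 * \<kappa> * (1 + \<xi> ^ 4) * real n / (sqrt (real n)) ^ 3"
    by (simp add: card_Plus)
  also have "\<dots> = 64 * \<kappa> * (1 + \<xi> ^ 4) / sqrt (real n)"
    using n by (simp add: power3_eq_cube)
  finally have main: "cmod (M.expectation (\<lambda>\<omega>. iexp (\<Sum>i\<in>freqs 0 n. t i * U i \<omega>)) - exp (- ((\<Sum>i\<in>freqs 0 n. (t i)\<^sup>2) / 2)))
    \<le> 64 * \<kappa> * (1 + \<xi> ^ 4) / sqrt (real n)" .
  have e1: "(\<Sum>i\<in>freqs 0 n. t i * U i \<omega>) = \<xi> * ((\<Sum>i\<in>freqs 0 n. w i * U i \<omega>) / sqrt (real n))" for \<omega>
    by (simp only: t_def sum_distrib_left sum_divide_distrib) (auto intro!: sum.cong)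
  have e2: "(\<Sum>i\<in>freqs 0 n. (t i)\<^sup>2) / 2 = \<xi>\<^sup>2 * (\<Sum>i\<in>freqs 0 n. (w i)\<^sup>2) / (2 * real n)"
    by (simp only: t_def sum_distrib_left sum_divide_distrib) (auto intro!: sum.cong simp: power_divide power_mult_distrib)
  show ?thesis
    using main unfolding e1 e2 .
qed

lemma iexp_f_approx:
  assumes n: "1 \<le> n"
  shows "cmod (M.expectation (\<lambda>\<omega>. iexp (\<xi> * f n \<omega> x)) - exp (- (\<xi>\<^sup>2 / 2)))
    \<le> 64 * \<kappa> * (1 + \<xi> ^ 4) / sqrt (real n)"
proof -
  have "\<bar>trig i x\<bar> \<le> 2" for i using abs_trig_le[of i x] by simp
  from iexp_weighted_sum_approx[OF n, where w = "\<lambda>i. trig i x" and \<xi> = \<xi>, OF this] n show ?thesis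
    unfolding sum_trig_square f_def S_def by simp
qed

lemma iexp_f_diff_approx:
  assumes n: "1 \<le> n"
  shows "cmod (M.expectation (\<lambda>\<omega>. iexp (\<xi> * (f n \<omega> x - f n \<omega> y)))
       - exp (- (\<xi>\<^sup>2 * (1 - dirichlet_mean n (x - y)))))
    \<le> 64 * \<kappa> * (1 + \<xi> ^ 4) / sqrt (real n)"
proof -
  have "\<bar>trig i x - trig i y\<bar> \<le> 2" for i using abs_trig_le[of i x] abs_trig_le[of i y] by linarith
  from iexp_weighted_sum_approx[OF n, where w = "\<lambda>i. trig i x - trig i y" and \<xi> = \<xi>, OF this] n
  show ?thesis
    unfolding sum_trig_diff_square f_def S_def
    by (simp add: left_diff_distrib sum_subtractf diff_divide_distrib)
qed

section \<open>Mean-square error of the characteristic function for fixed coefficients\<close>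

definition cf :: "nat \<Rightarrow> 'a \<Rightarrow> real \<Rightarrow> complex"
  where "cf n \<omega> \<xi> = P.expectation (\<lambda>t. iexp (\<xi> * f n \<omega> t))"

lemma cf_measurable [measurable]: "(\<lambda>\<omega>. cf n \<omega> \<xi>) \<in> borel_measurable M"
  unfolding cf_def by measurable

text \<open>If the Gaussian approximations were exact, the mean of \<open>G \<omega> (x, y)\<close>
  would be exp(-\<xi>^2 (1 - D)) - exp(-\<xi>^2), where D is the covariance at x and y; so only
  correlation survives. The actual approximations cost three errors \<open>B\<close>, one two-point
  and two one-point, whence 192 = 3 * 64.\<close>

lemma cf_second_moment:
  assumes decay: "\<And>k::int. k \<noteq> 0 \<Longrightarrow> cmod (char P (of_int k)) \<le> C / \<bar>of_int k\<bar> powr \<alpha>"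
    and \<alpha>: "0 < \<alpha>" and C: "0 \<le> C" and n: "1 \<le> n"
  shows "(\<integral>\<^sup>+\<omega>. ennreal ((cmod (cf n \<omega> \<xi> - exp (- (\<xi>\<^sup>2 / 2))))\<^sup>2) \<partial>M)
    \<le> ennreal ((192 * \<kappa> + 3 + C\<^sup>2) * (1 + \<xi> ^ 4) * real n powr - min (1/4) (\<alpha>/2))"
proof -
  define c where "c = exp (- (\<xi>\<^sup>2 / 2))"
  define H where "H \<omega> t = iexp (\<xi> * f n \<omega> t) - complex_of_real c" for \<omega> t
  define G where "G \<omega> z = H \<omega> (fst z) * cnj (H \<omega> (snd z))" for \<omega> z
  define B where "B = 64 * \<kappa> * (1 + \<xi> ^ 4) / sqrt (real n)"
  define \<delta> where "\<delta> = min (1/4) (\<alpha>/2)"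
  have c: "0 \<le> c" "c \<le> 1" by (auto simp: c_def)
  have B0: "0 \<le> B" using kappa by (simp add: B_def)
  have [measurable]: "cnj \<in> borel_measurable borel"
    by (intro borel_measurable_continuous_onI) (auto intro!: continuous_intros)
  have H_meas[measurable]: "H \<omega> \<in> borel_measurable borel" for \<omega> unfolding H_def by measurable
  have H_le: "cmod (H \<omega> t) \<le> 2" for \<omega> t
    using norm_triangle_ineq4[of "iexp (\<xi> * f n \<omega> t)" "complex_of_real c"] c by (simp add: H_def)
  have G_meas[measurable]: "(\<lambda>z. G (fst z) (snd z)) \<in> borel_measurable (M \<Otimes>\<^sub>M (P \<Otimes>\<^sub>M P))"
    unfolding G_def H_def by measurable
  have G_le: "cmod (G \<omega> z) \<le> 2 * 2" for \<omega> z
    unfolding G_def norm_mult complex_mod_cnj by (intro mult_mono H_le) auto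
  have int_iexp: "integrable P (\<lambda>t. iexp (\<xi> * f n \<omega> t))" for \<omega>
    by (rule P.integrable_const_bound[of _ 1]) auto
  have "P.expectation (H \<omega>) = cf n \<omega> \<xi> - c" for \<omega>
    unfolding H_def cf_def using int_iexp P.prob_space by simp
  then have sq: "(cmod (cf n \<omega> \<xi> - c))\<^sup>2 = Re (\<integral>z. G \<omega> z \<partial>(P \<Otimes>\<^sub>M P))" for \<omega>
    unfolding G_def by (subst P.integral_pair_mult_cnj(2)[OF H_meas H_le])
      (simp only: complex_norm_square[symmetric] Re_complex_of_real)
  have intG: "integrable (M \<Otimes>\<^sub>M (P \<Otimes>\<^sub>M P)) (case_prod G)"
    by (rule MPP.P.integrable_const_bound[of _ 4])
       (use G_le in \<open>auto simp: split_beta'\<close>)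
  have point: "cmod (M.expectation (\<lambda>\<omega>. G \<omega> z)) \<le> 3 * B + \<xi>\<^sup>2 * \<bar>dirichlet_mean n (fst z - snd z)\<bar>" for z
  proof -
    obtain x y where z: "z = (x, y)" by (cases z)
    define D where "D = dirichlet_mean n (x - y)"
    have int1: "integrable M (\<lambda>\<omega>. iexp (r * f n \<omega> u))" for r u
      by (rule M.integrable_const_bound[of _ 1]) auto
    have int2: "integrable M (\<lambda>\<omega>. iexp (\<xi> * (f n \<omega> x - f n \<omega> y)))"
      by (rule M.integrable_const_bound[of _ 1]) (auto intro!: AE_I2 simp flip: of_real_diff of_real_mult)
    have G_eq: "G \<omega> z = iexp (\<xi> * (f n \<omega> x - f n \<omega> y)) - c * iexp (\<xi> * f n \<omega> x)
        - c * iexp ((- \<xi>) * f n \<omega> y) + complex_of_real (c\<^sup>2)" for \<omega>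
    proof -
      have "cnj (iexp (\<xi> * f n \<omega> y)) = iexp ((- \<xi>) * f n \<omega> y)"
        by (simp add: exp_cnj)
      moreover have "iexp (\<xi> * (f n \<omega> x - f n \<omega> y)) = iexp (\<xi> * f n \<omega> x) * iexp ((- \<xi>) * f n \<omega> y)"
        by (simp add: algebra_simps flip: exp_add)
      ultimately show ?thesis
        by (simp add: G_def H_def z algebra_simps power2_eq_square)
    qed
    define E1 E2 E3 where "E1 = M.expectation (\<lambda>\<omega>. iexp (\<xi> * (f n \<omega> x - f n \<omega> y)))"
      and "E2 = M.expectation (\<lambda>\<omega>. iexp (\<xi> * f n \<omega> x))"
      and "E3 = M.expectation (\<lambda>\<omega>. iexp ((- \<xi>) * f n \<omega> y))"
    have EG: "M.expectation (\<lambda>\<omega>. G \<omega> z) = E1 - c * E2 - c * E3 + complex_of_real (c\<^sup>2)"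
      unfolding G_eq E1_def E2_def E3_def
      using int1[of \<xi> x] int1[of "- \<xi>" y] int2
      by (subst Bochner_Integration.integral_add Bochner_Integration.integral_diff integral_mult_right;
          simp add: M.prob_space del: of_real_mult of_real_diff)+
    have 1: "cmod (E1 - exp (- (\<xi>\<^sup>2 * (1 - D)))) \<le> B"
      unfolding E1_def D_def B_def by (rule iexp_f_diff_approx[OF n])
    have 2: "cmod (E2 - c) \<le> B"
      unfolding E2_def c_def B_def by (rule iexp_f_approx[OF n])
    have 3: "cmod (E3 - c) \<le> B"
      unfolding E3_def c_def B_def using iexp_f_approx[OF n, of "- \<xi>" y] by simp
    have "\<bar>exp (- (\<xi>\<^sup>2 * (1 - D))) - exp (- \<xi>\<^sup>2)\<bar> \<le> \<bar>\<xi>\<^sup>2 * (1 - D) - \<xi>\<^sup>2\<bar>"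
      using abs_dirichlet_mean_le[of n "x - y"] by (intro abs_exp_minus_diff_le) (auto simp: D_def)
    also have "\<dots> = \<xi>\<^sup>2 * \<bar>D\<bar>" by (simp add: algebra_simps abs_mult)
    also have "exp (- \<xi>\<^sup>2) = c\<^sup>2" by (simp add: c_def power2_eq_square flip: exp_add)
    finally have "cmod (complex_of_real (exp (- (\<xi>\<^sup>2 * (1 - D))) - c\<^sup>2)) \<le> \<xi>\<^sup>2 * \<bar>D\<bar>"
      by (simp only: norm_of_real)
    then have 4: "cmod (exp (- (\<xi>\<^sup>2 * (1 - D))) - complex_of_real (c\<^sup>2)) \<le> \<xi>\<^sup>2 * \<bar>D\<bar>" by simp
    have cB: "cmod (complex_of_real c * (E - c)) \<le> B" if "cmod (E - c) \<le> B" for E :: complex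
    proof -
      have "cmod (complex_of_real c * (E - c)) \<le> 1 * cmod (E - c)"
        unfolding norm_mult using c by (intro mult_right_mono) auto
      then show ?thesis using that by simp
    qed
    \<comment> \<open>Each one-point mean is recentered at \<open>c\<close>, which uses up two
      copies of \<open>c\<^sup>2\<close>; the one left over is matched with the two-point
      Gaussian.\<close>
    have "E1 - c * E2 - c * E3 + complex_of_real (c\<^sup>2) =
        (E1 - exp (- (\<xi>\<^sup>2 * (1 - D)))) + (exp (- (\<xi>\<^sup>2 * (1 - D))) - complex_of_real (c\<^sup>2))
        + (- (c * (E2 - c)) + - (c * (E3 - c)))"
      by (simp add: algebra_simps power2_eq_square)
    also have "cmod \<dots> \<le> (B + \<xi>\<^sup>2 * \<bar>D\<bar>) + (B + B)"
      by (intro order_trans[OF norm_triangle_ineq] add_mono 1 4) (simp_all only: norm_minus_cancel cB[OF 2] cB[OF 3])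
    finally show ?thesis
      unfolding EG by (simp add: D_def z)
  qed
  have intD: "integrable (P \<Otimes>\<^sub>M P) (\<lambda>z. \<bar>dirichlet_mean n (fst z - snd z)\<bar>)"
    by (rule PP.P.integrable_const_bound[of _ 1]) (auto simp: abs_dirichlet_mean_le)
  have intsq: "integrable M (\<lambda>\<omega>. (cmod (cf n \<omega> \<xi> - c))\<^sup>2)"
  proof (rule M.integrable_const_bound[of _ "2\<^sup>2"])
    have "cmod (cf n \<omega> \<xi>) \<le> 1" for \<omega>
      unfolding cf_def by (rule order_trans[OF integral_norm_bound]) (simp add: P.prob_space)
    then have "cmod (cf n \<omega> \<xi> - c) \<le> 2" for \<omega>
      using norm_triangle_ineq4[of "cf n \<omega> \<xi>" "complex_of_real c"] c by (smt (verit) norm_of_real)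
    then show "AE \<omega> in M. norm ((cmod (cf n \<omega> \<xi> - c))\<^sup>2) \<le> 2\<^sup>2"
      unfolding real_norm_def power_abs abs_norm_cancel by (intro AE_I2 power_mono norm_ge_zero)
  qed measurable
  have "M.expectation (\<lambda>\<omega>. (cmod (cf n \<omega> \<xi> - c))\<^sup>2) = Re (\<integral>\<omega>. (\<integral>z. G \<omega> z \<partial>(P \<Otimes>\<^sub>M P)) \<partial>M)"
    unfolding sq using MPP.integrable_fst'[OF intG] by (subst integral_Re) simp_all
  also have "\<dots> = Re (\<integral>z. (\<integral>\<omega>. G \<omega> z \<partial>M) \<partial>(P \<Otimes>\<^sub>M P))"
    by (subst MPP.Fubini_integral[OF intG]) simp
  also have "\<dots> \<le> cmod (\<integral>z. (\<integral>\<omega>. G \<omega> z \<partial>M) \<partial>(P \<Otimes>\<^sub>M P))"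
    by (rule complex_Re_le_cmod)
  also have "\<dots> \<le> (\<integral>z. cmod (\<integral>\<omega>. G \<omega> z \<partial>M) \<partial>(P \<Otimes>\<^sub>M P))"
    by (rule integral_norm_bound)
  also have "\<dots> \<le> (\<integral>z. 3 * B + \<xi>\<^sup>2 * \<bar>dirichlet_mean n (fst z - snd z)\<bar> \<partial>(P \<Otimes>\<^sub>M P))"
    using intD B0 by (intro integral_mono' point) auto
  also have "\<dots> = 3 * B + \<xi>\<^sup>2 * (\<integral>z. \<bar>dirichlet_mean n (fst z - snd z)\<bar> \<partial>(P \<Otimes>\<^sub>M P))"
    using intD by (simp add: PP.P.prob_space)
  also have "\<dots> \<le> 3 * (64 * \<kappa> * (1 + \<xi> ^ 4) * real n powr - \<delta>)
      + (1 + \<xi> ^ 4) * ((3 + C\<^sup>2) * real n powr - \<delta>)"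
  proof (intro add_mono mult_mono)
    have "1 / sqrt (real n) = real n powr (- (1/2))"
      using n by (simp add: powr_minus_divide powr_half_sqrt)
    also have "\<dots> \<le> real n powr - \<delta>"
      using n by (intro powr_mono) (auto simp: \<delta>_def)
    finally have "64 * \<kappa> * (1 + \<xi> ^ 4) * (1 / sqrt (real n)) \<le> 64 * \<kappa> * (1 + \<xi> ^ 4) * real n powr - \<delta>"
      using kappa by (intro mult_left_mono) auto
    then show "B \<le> 64 * \<kappa> * (1 + \<xi> ^ 4) * real n powr - \<delta>" by (simp add: B_def)
    show "\<xi>\<^sup>2 \<le> 1 + \<xi> ^ 4" using power_le_one_plus_power4[of 2 \<xi>] by simp
    show "(\<integral>z. \<bar>dirichlet_mean n (fst z - snd z)\<bar> \<partial>(P \<Otimes>\<^sub>M P)) \<le> (3 + C\<^sup>2) * real n powr - \<delta>"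
      unfolding \<delta>_def by (rule P.integral_dirichlet_mean_le[OF decay \<alpha> C n])
  qed (auto simp: B0)
  also have "\<dots> = (192 * \<kappa> + 3 + C\<^sup>2) * (1 + \<xi> ^ 4) * real n powr - \<delta>"
    by (simp add: algebra_simps)
  finally have *: "M.expectation (\<lambda>\<omega>. (cmod (cf n \<omega> \<xi> - c))\<^sup>2) \<le> \<dots>" .
  have "(\<integral>\<^sup>+\<omega>. ennreal ((cmod (cf n \<omega> \<xi> - c))\<^sup>2) \<partial>M) = ennreal (M.expectation (\<lambda>\<omega>. (cmod (cf n \<omega> \<xi> - c))\<^sup>2))"
    by (intro nn_integral_eq_integral intsq) auto
  then show ?thesis
    using * unfolding c_def \<delta>_def by (simp add: ennreal_leI)
qed

section \<open>Fourth-moment maximal bound for blocks of frequencies\<close>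

definition d :: "nat \<Rightarrow> nat \<Rightarrow> 'a \<Rightarrow> real"
  where "d m n \<omega> = P.expectation (\<lambda>t. S m n \<omega> t ^ 4)"

lemma d_measurable [measurable]: "d m n \<in> borel_measurable M"
  unfolding d_def by measurable

lemma d_nonneg: "0 \<le> d m n \<omega>"
  unfolding d_def by simp

lemma d_refl: "d m m \<omega> = 0"
  by (simp add: d_def S_def Plus_def)

lemma S_power4_integrable: "integrable P (\<lambda>t. S m n \<omega> t ^ 4)"
proof (rule P.integrable_const_bound[of _ "(\<Sum>i\<in>freqs m n. \<bar>U i \<omega>\<bar>) ^ 4"])
  show "AE t in P. norm (S m n \<omega> t ^ 4) \<le> (\<Sum>i\<in>freqs m n. \<bar>U i \<omega>\<bar>) ^ 4"
    unfolding real_norm_def power_abs by (intro AE_I2 power_mono S_bounded abs_ge_zero)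
qed measurable

lemma d_split: "m \<le> l \<Longrightarrow> l \<le> n \<Longrightarrow> d m n \<omega> \<le> 125 * d m l \<omega> + 2 * d l n \<omega>"
proof -
  assume *: "m \<le> l" "l \<le> n"
  have "d m n \<omega> \<le> P.expectation (\<lambda>t. 125 * S m l \<omega> t ^ 4 + 2 * S l n \<omega> t ^ 4)"
    unfolding d_def
    by (intro integral_mono Bochner_Integration.integrable_add integrable_mult_right S_power4_integrable)
       (simp only: S_split[OF *] add_power4_le)
  also have "\<dots> = 125 * d m l \<omega> + 2 * d l n \<omega>"
    using S_power4_integrable by (simp add: d_def)
  finally show ?thesis .
qed

text \<open>The moment bound for \<open>S m n\<close> is uniform in \<open>t\<close>, so Fubini
  passes it to the average over \<open>P\<close>, whatever \<open>P\<close> is.\<close>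

lemma d_moment:
  "integrable M (d m n)" "M.expectation (d m n) \<le> 12 * \<kappa> * (real n - real m)\<^sup>2"
proof -
  have "(\<integral>\<^sup>+\<omega>. ennreal (d m n \<omega>) \<partial>M) = (\<integral>\<^sup>+\<omega>. (\<integral>\<^sup>+t. ennreal (S m n \<omega> t ^ 4) \<partial>P) \<partial>M)"
    unfolding d_def using S_power4_integrable by (subst nn_integral_eq_integral) auto
  also have "\<dots> = (\<integral>\<^sup>+t. (\<integral>\<^sup>+\<omega>. ennreal (S m n \<omega> t ^ 4) \<partial>M) \<partial>P)"
    by (rule MP.Fubini'[symmetric]) (simp add: split_beta')
  also have "\<dots> \<le> (\<integral>\<^sup>+t. ennreal (12 * \<kappa> * (real n - real m)\<^sup>2) \<partial>P)"
    by (intro nn_integral_mono, subst nn_integral_eq_integral)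
       (auto intro!: S_fourth_moment ennreal_leI)
  also have "\<dots> = ennreal (12 * \<kappa> * (real n - real m)\<^sup>2)"
    using P.emeasure_space_1 by simp
  finally have *: "(\<integral>\<^sup>+\<omega>. ennreal (d m n \<omega>) \<partial>M) \<le> ennreal (12 * \<kappa> * (real n - real m)\<^sup>2)" .
  then show int: "integrable M (d m n)"
    by (intro integrableI_nonneg) (auto simp: d_nonneg intro: le_less_trans)
  show "M.expectation (d m n) \<le> 12 * \<kappa> * (real n - real m)\<^sup>2"
    using * kappa by (subst (asm) nn_integral_eq_integral[OF int]) (auto simp: d_nonneg)
qed

text \<open>Chaining majorant: \<open>Q r m\<close> dominates \<open>d m n\<close> for all \<open>n\<close> in the dyadic block
  \<open>m \<le> n \<le> m + 2 ^ r\<close>. Its mean grows by at most the factor \<open>1 + 2 < 4\<close> per level up to an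
  error of order \<open>4 ^ r\<close>, so it stays of order \<open>4 ^ r\<close>; this uses that the second
  constant in \<open>add_power4_le\<close> is less than 3.\<close>

primrec Q :: "nat \<Rightarrow> nat \<Rightarrow> 'a \<Rightarrow> real" where
  "Q 0 m \<omega> = d m (Suc m) \<omega>"
| "Q (Suc r) m \<omega> = Q r m \<omega> + 125 * d m (m + 2 ^ r) \<omega> + 2 * Q r (m + 2 ^ r) \<omega>"

lemma Q_nonneg: "0 \<le> Q r m \<omega>"
  by (induction r arbitrary: m) (auto simp: d_nonneg)

text \<open>Binary descent: an \<open>n\<close> in the first half of the block falls to
  \<open>Q r m\<close>, one in the second half is reached through the midpoint. Adding the two cases
  instead of taking a maximum keeps the mean computable.\<close>

lemma d_le_Q: "m \<le> n \<Longrightarrow> n \<le> m + 2 ^ r \<Longrightarrow> d m n \<omega> \<le> Q r m \<omega>"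
proof (induction r arbitrary: m)
  case 0
  then consider "n = m" | "n = Suc m" by force
  then show ?case
    by cases (simp_all add: d_refl d_nonneg)
next
  case (Suc r)
  show ?case
  proof (cases "n \<le> m + 2 ^ r")
    case True
    then have "d m n \<omega> \<le> Q r m \<omega>" using Suc by blast
    then show ?thesis
      using d_nonneg[of m "m + 2 ^ r" \<omega>] Q_nonneg[of r "m + 2 ^ r" \<omega>] by simp
  next
    case False
    then have "d (m + 2 ^ r) n \<omega> \<le> Q r (m + 2 ^ r) \<omega>" using Suc by (intro Suc.IH) auto
    moreover have "d m n \<omega> \<le> 125 * d m (m + 2 ^ r) \<omega> + 2 * d (m + 2 ^ r) n \<omega>"
      using False by (intro d_split) auto
    ultimately show ?thesis
      using Q_nonneg[of r m \<omega>] by simp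
  qed
qed

text \<open>The constant K = 1500 \<kappa> is the fixed point of the recursion: K + 125 * 12
  \<kappa> + 2 K = 4 K.\<close>

lemma Q_moment: "integrable M (Q r m) \<and> M.expectation (Q r m) \<le> 1500 * \<kappa> * 4 ^ r"
proof (induction r arbitrary: m)
  case 0
  have "M.expectation (d m (Suc m)) \<le> 12 * \<kappa>" using d_moment(2)[of m "Suc m"] by simp
  then show ?case using d_moment(1)[of m "Suc m"] kappa by (auto simp: Q.simps[abs_def])
next
  case (Suc r)
  have dm: "M.expectation (d m (m + 2 ^ r)) \<le> 12 * \<kappa> * 4 ^ r"
  proof -
    have "(2 ^ r)\<^sup>2 = (4 ^ r :: real)" by (simp add: power2_eq_square flip: power_mult_distrib)
    then show ?thesis using d_moment(2)[of m "m + 2 ^ r"] by simp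
  qed
  have "M.expectation (Q (Suc r) m) = M.expectation (Q r m) + 125 * M.expectation (d m (m + 2 ^ r))
      + 2 * M.expectation (Q r (m + 2 ^ r))"
    using Suc d_moment(1) by (simp add: Q.simps(2)[abs_def])
  also have "\<dots> \<le> 1500 * \<kappa> * 4 ^ r + 125 * (12 * \<kappa> * 4 ^ r) + 2 * (1500 * \<kappa> * 4 ^ r)"
    by (intro add_mono mult_left_mono Suc[THEN conjunct2] dm) auto
  also have "\<dots> = 1500 * \<kappa> * 4 ^ Suc r" by simp
  finally show ?case using Suc d_moment(1) by (simp add: Q.simps(2)[abs_def])
qed

end

subsection \<open>Interpolation along a subsequence\<close>

text \<open>On [0, 1] the convex function (1 + x)^p lies below its chord; at x = 1/J this bounds the
  relative gap between consecutive p-th powers by 2^p / J.\<close>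

lemma power_Suc_le_gap:
  fixes J p :: nat
  assumes J: "1 \<le> J"
  shows "real ((J + 1) ^ p) \<le> real (J ^ p) + 2 ^ p * real (J ^ p) / real J"
proof -
  have bern: "(1 + x) ^ p \<le> 1 + (2 ^ p - 1) * x" if "0 \<le> x" "x \<le> 1" for x :: real
  proof (induction p)
    case (Suc p)
    have "(1 + x) ^ Suc p \<le> (1 + x) * (1 + (2 ^ p - 1) * x)"
      using Suc that by (simp add: mult_left_mono)
    also have "\<dots> = 1 + 2 ^ p * x + (2 ^ p - 1) * (x * x)" by (simp add: algebra_simps)
    also have "\<dots> \<le> 1 + 2 ^ p * x + (2 ^ p - 1) * (x * 1)"
      using that by (intro add_mono mult_left_mono) auto
    also have "\<dots> = 1 + (2 ^ Suc p - 1) * x" by (simp add: algebra_simps)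
    finally show ?case .
  qed simp
  have "real ((J + 1) ^ p) = real J ^ p * (1 + 1 / real J) ^ p"
    using J by (simp flip: power_mult_distrib add: field_simps)
  also have "\<dots> \<le> real J ^ p * (1 + (2 ^ p - 1) * (1 / real J))"
    using J by (intro mult_left_mono bern) auto
  also have "\<dots> \<le> real J ^ p * (1 + 2 ^ p * (1 / real J))"
    by (intro mult_left_mono add_left_mono mult_right_mono) auto
  also have "\<dots> = real (J ^ p) + 2 ^ p * real (J ^ p) / real J"
    by (simp add: algebra_simps)
  finally show ?thesis .
qed

lemma ex_dyadic_between:
  fixes L :: real
  assumes "1 \<le> L"
  shows "\<exists>r::nat. L \<le> 2 ^ r \<and> 2 ^ r \<le> 2 * L"
proof -
  define r where "r = (LEAST r. L \<le> 2 ^ r)"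
  have ex: "\<exists>r. L \<le> 2 ^ r"
    by (meson less_imp_le one_less_numeral_iff real_arch_pow semiring_norm(76))
  then have "L \<le> 2 ^ r" unfolding r_def by (rule LeastI_ex)
  moreover have "2 ^ r \<le> 2 * L"
  proof (cases r)
    case 0
    then show ?thesis using assms by simp
  next
    case (Suc k)
    then have "\<not> L \<le> 2 ^ k" unfolding r_def by (intro not_less_Least) simp
    then show ?thesis using Suc by simp
  qed
  ultimately show ?thesis by blast
qed

lemma ex_floor_root:
  fixes p n :: nat
  assumes "1 \<le> p" "1 \<le> n"
  shows "\<exists>J\<ge>1. J ^ p \<le> n \<and> n < (J + 1) ^ p"
proof -
  define K where "K = (LEAST K. n < K ^ p)"
  have "n < (n + 1) ^ p"
    using assms self_le_power[of "n + 1" p] by simp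
  then have K: "n < K ^ p" unfolding K_def by (rule LeastI)
  have "K \<noteq> 0" using K assms by (auto simp: zero_power intro!: Nat.gr0I)
  then obtain J where J: "K = J + 1" by (metis Suc_eq_plus1 not0_implies_Suc)
  have "\<not> n < J ^ p" using J unfolding K_def by (intro not_less_Least) simp
  moreover have "J \<noteq> 0" using J K assms by (auto intro!: Nat.gr0I)
  ultimately show ?thesis using J K by (intro exI[of _ J]) auto
qed

lemma le_root4: "0 \<le> x \<Longrightarrow> x ^ 4 \<le> y \<Longrightarrow> x \<le> root 4 y"
  by (metis real_root_le_iff real_root_power_cancel zero_less_numeral)

lemma abs_inverse_sqrt_diff_le:
  fixes m n :: real
  assumes "0 < m" "m \<le> n"
  shows "\<bar>1 / sqrt n - 1 / sqrt m\<bar> \<le> (n - m) / m / sqrt m"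
proof -
  have n: "0 < n" using assms by simp
  define q where "q = sqrt m / sqrt n"
  have q: "0 \<le> q" "q \<le> 1" using assms by (auto simp: q_def)
  have "1 - q \<le> 1 - q * q" using q mult_left_le_one_le[of q q] by simp
  also have "q * q = m / n" using assms by (simp add: q_def)
  also have "1 - m / n = (n - m) / n" using n by (simp add: field_simps)
  also have "\<dots> \<le> (n - m) / m" using assms by (intro divide_left_mono) auto
  finally have "(1 - q) / sqrt m \<le> (n - m) / m / sqrt m"
    using assms by (intro divide_right_mono) auto
  moreover have "1 / sqrt m - 1 / sqrt n = (1 - q) / sqrt m"
    using assms by (simp add: q_def field_simps)
  moreover have "0 \<le> 1 / sqrt m - 1 / sqrt n" using assms by (simp add: field_simps)
  ultimately show ?thesis by linarith
qed

lemma norm_iexp_diff_le: "cmod (iexp x - iexp y) \<le> \<bar>x - y\<bar>" for x y :: real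
proof -
  have "iexp x - iexp y = iexp y * (iexp (x - y) - 1)"
    by (simp add: right_diff_distrib flip: exp_add)
  then have "cmod (iexp x - iexp y) = cmod (iexp (x - y) - 1)"
    by (simp only: norm_mult norm_exp_i_times mult_1_left)
  also have "\<dots> \<le> \<bar>x - y\<bar>"
    using iexp_approx1[of "x - y" 0] by simp
  finally show ?thesis .
qed

context random_trig_sum
begin

lemma S_abs_bounded_integrable [simp]: "integrable P (\<lambda>t. \<bar>S m n \<omega> t\<bar>)"
  by (rule P.integrable_const_bound[of _ "\<Sum>i\<in>freqs m n. \<bar>U i \<omega>\<bar>"]) (auto intro: S_bounded)

lemma f_abs_integrable [simp]: "integrable P (\<lambda>t. \<bar>f n \<omega> t\<bar>)"
  unfolding f_def abs_divide by (intro integrable_divide) simp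

lemma integral_abs_S_le: "P.expectation (\<lambda>t. \<bar>S m n \<omega> t\<bar>) ^ 4 \<le> d m n \<omega>"
  using P.power4_expectation_abs_le[of "S m n \<omega>", OF _ S_bounded] by (simp add: d_def)

lemma integral_abs_f_le: "P.expectation (\<lambda>t. \<bar>f n \<omega> t\<bar>) ^ 4 \<le> d 0 n \<omega> / (real n)\<^sup>2"
proof -
  have "P.expectation (\<lambda>t. \<bar>f n \<omega> t\<bar>) ^ 4 = P.expectation (\<lambda>t. \<bar>S 0 n \<omega> t\<bar>) ^ 4 / (sqrt (real n)) ^ 4"
    by (simp add: f_def power_divide)
  also have "(sqrt (real n)) ^ 4 = (real n)\<^sup>2" by (simp add: power4_eq_xxxx power2_eq_square)
  finally show ?thesis using integral_abs_S_le[of 0 n \<omega>] by (simp add: divide_right_mono)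
qed

lemma cf_diff_le:
  "cmod (cf n \<omega> \<xi> - cf m \<omega> \<eta>) \<le> P.expectation (\<lambda>t. \<bar>\<xi> * f n \<omega> t - \<eta> * f m \<omega> t\<bar>)"
proof -
  have i: "integrable P (\<lambda>t. iexp (r * f k \<omega> t))" for r k
    by (rule P.integrable_const_bound[of _ 1]) auto
  have fi: "integrable P (f k \<omega>)" for k
    using f_abs_integrable[of k \<omega>] by (subst (asm) integrable_abs_iff) auto
  have "cf n \<omega> \<xi> - cf m \<omega> \<eta> = P.expectation (\<lambda>t. iexp (\<xi> * f n \<omega> t) - iexp (\<eta> * f m \<omega> t))"
    unfolding cf_def by (rule Bochner_Integration.integral_diff[OF i i, symmetric])
  also have "cmod \<dots> \<le> P.expectation (\<lambda>t. cmod (iexp (\<xi> * f n \<omega> t) - iexp (\<eta> * f m \<omega> t)))"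
    by (rule integral_norm_bound)
  also have "\<dots> \<le> P.expectation (\<lambda>t. \<bar>\<xi> * f n \<omega> t - \<eta> * f m \<omega> t\<bar>)"
    by (intro integral_mono integrable_norm Bochner_Integration.integrable_diff i integrable_abs
         integrable_mult_right fi norm_iexp_diff_le)
  finally show ?thesis .
qed

text \<open>The three quantities that have to vanish along the subsequence \<open>J ^ p\<close>: the error of the
  characteristic function on a grid of mesh \<open>1 / J\<close>, the size of \<open>f\<close> relative to the mesh, and
  the fluctuation between \<open>J ^ p\<close> and \<open>(J + 1) ^ p\<close>.\<close>

definition grid_error :: "nat \<Rightarrow> nat \<Rightarrow> 'a \<Rightarrow> real"
  where "grid_error p J \<omega> = (\<Sum>r\<in>{- int (J\<^sup>2) .. int (J\<^sup>2)}.
    (cmod (cf (J ^ p) \<omega> (of_int r / real J) - exp (- ((of_int r / real J)\<^sup>2 / 2))))\<^sup>2)"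

definition size_error :: "nat \<Rightarrow> nat \<Rightarrow> 'a \<Rightarrow> real"
  where "size_error p J \<omega> = d 0 (J ^ p) \<omega> / (real (J ^ p))\<^sup>2 / real J ^ 4"

definition gap_error :: "nat \<Rightarrow> nat \<Rightarrow> nat \<Rightarrow> 'a \<Rightarrow> real"
  where "gap_error p R J \<omega> = Q R (J ^ p) \<omega> / (real (J ^ p))\<^sup>2"

text \<open>The error is split along the chain from (n, \<xi>) to (m, \<xi>) to the grid point (m,
  \<eta>), then to the Gaussian at \<eta> and at \<xi>, with m = J^p. The bound on
  \<open>2 ^ R\<close> makes the dyadic block starting at m cover \<open>n\<close>.\<close>

lemma cf_error_le:
  fixes J n p R :: nat and \<xi> :: real
  assumes J: "1 \<le> J" "\<bar>\<xi>\<bar> + 1 \<le> real J" and n: "J ^ p \<le> n" "n < (J + 1) ^ p"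
    and R: "2 ^ p * real (J ^ p) / real J \<le> 2 ^ R"
  shows "cmod (cf n \<omega> \<xi> - exp (- (\<xi>\<^sup>2 / 2)))
    \<le> \<bar>\<xi>\<bar> * (root 4 (gap_error p R J \<omega>) + 2 ^ p * root 4 (size_error p J \<omega>))
      + root 4 (size_error p J \<omega>) + sqrt (grid_error p J \<omega>) + (\<bar>\<xi>\<bar> + 1) / real J"
proof -
  define m where "m = J ^ p"
  have m: "1 \<le> m" "m \<le> n" using J n by (auto simp: m_def)
  have m0: "0 < sqrt (real m)" using m by simp
  have J0: "0 < real J" using J by simp
  have gap: "real n \<le> real m + 2 ^ p * real m / real J"
    using power_Suc_le_gap[OF J(1), of p] n by (simp add: m_def flip: of_nat_power)
  have nR: "n \<le> m + 2 ^ R"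
  proof -
    have "real n \<le> real m + 2 ^ R" using gap R by (simp add: m_def)
    then have "real n \<le> real (m + 2 ^ R)" by simp
    then show ?thesis by (simp only: of_nat_le_iff)
  qed
  have size: "P.expectation (\<lambda>t. \<bar>f m \<omega> t\<bar>) / real J \<le> root 4 (size_error p J \<omega>)"
  proof (rule le_root4)
    show "(P.expectation (\<lambda>t. \<bar>f m \<omega> t\<bar>) / real J) ^ 4 \<le> size_error p J \<omega>"
      unfolding size_error_def m_def power_divide by (intro divide_right_mono integral_abs_f_le) simp
  qed simp
  have step: "P.expectation (\<lambda>t. \<bar>S m n \<omega> t\<bar>) / sqrt (real m) \<le> root 4 (gap_error p R J \<omega>)"
  proof (rule le_root4)
    have "(P.expectation (\<lambda>t. \<bar>S m n \<omega> t\<bar>) / sqrt (real m)) ^ 4 \<le> Q R m \<omega> / (sqrt (real m)) ^ 4"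
      unfolding power_divide using m nR
      by (intro divide_right_mono order_trans[OF integral_abs_S_le d_le_Q]) auto
    also have "(sqrt (real m)) ^ 4 = (real m)\<^sup>2" by (simp add: power4_eq_xxxx power2_eq_square)
    finally show "(P.expectation (\<lambda>t. \<bar>S m n \<omega> t\<bar>) / sqrt (real m)) ^ 4 \<le> gap_error p R J \<omega>"
      by (simp add: gap_error_def m_def)
  qed simp

  have "cmod (cf n \<omega> \<xi> - cf m \<omega> \<xi>) \<le> P.expectation (\<lambda>t. \<bar>\<xi> * f n \<omega> t - \<xi> * f m \<omega> t\<bar>)"
    by (rule cf_diff_le)
  also have "\<dots> \<le> P.expectation (\<lambda>t. \<bar>\<xi>\<bar> * (\<bar>S m n \<omega> t\<bar> / sqrt (real m) + 2 ^ p * (\<bar>f m \<omega> t\<bar> / real J)))"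
  proof (intro integral_mono')
    fix t
    \<comment> \<open>Two effects are separated: the new frequencies, and the change of
      normalization of the old ones.\<close>
    have "f n \<omega> t - f m \<omega> t = S m n \<omega> t / sqrt (real n) + S 0 m \<omega> t * (1 / sqrt (real n) - 1 / sqrt (real m))"
      using S_split[of 0 m n \<omega> t] m by (simp add: f_def algebra_simps add_divide_distrib)
    also have "\<bar>\<dots>\<bar> \<le> \<bar>S m n \<omega> t\<bar> / sqrt (real n) + \<bar>S 0 m \<omega> t\<bar> * \<bar>1 / sqrt (real n) - 1 / sqrt (real m)\<bar>"
      by (rule order_trans[OF abs_triangle_ineq]) (simp add: abs_mult)
    also have "\<dots> \<le> \<bar>S m n \<omega> t\<bar> / sqrt (real m) + \<bar>S 0 m \<omega> t\<bar> * (2 ^ p / real J / sqrt (real m))"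
    proof (intro add_mono mult_left_mono)
      show "\<bar>S m n \<omega> t\<bar> / sqrt (real n) \<le> \<bar>S m n \<omega> t\<bar> / sqrt (real m)"
        using m by (intro divide_left_mono) auto
      have "\<bar>1 / sqrt (real n) - 1 / sqrt (real m)\<bar> \<le> (real n - real m) / real m / sqrt (real m)"
        using m by (intro abs_inverse_sqrt_diff_le) auto
      also have "\<dots> \<le> (2 ^ p * real m / real J) / real m / sqrt (real m)"
        using gap by (intro divide_right_mono) auto
      also have "\<dots> = 2 ^ p / real J / sqrt (real m)" using m by simp
      finally show "\<bar>1 / sqrt (real n) - 1 / sqrt (real m)\<bar> \<le> 2 ^ p / real J / sqrt (real m)" .
    qed auto
    also have "\<dots> = \<bar>S m n \<omega> t\<bar> / sqrt (real m) + 2 ^ p * (\<bar>f m \<omega> t\<bar> / real J)"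
      by (simp add: f_def abs_divide ac_simps)
    finally show "\<bar>\<xi> * f n \<omega> t - \<xi> * f m \<omega> t\<bar> \<le> \<bar>\<xi>\<bar> * (\<bar>S m n \<omega> t\<bar> / sqrt (real m) + 2 ^ p * (\<bar>f m \<omega> t\<bar> / real J))"
      by (simp add: abs_mult mult_left_mono flip: right_diff_distrib)
  qed auto
  also have "\<dots> = \<bar>\<xi>\<bar> * (P.expectation (\<lambda>t. \<bar>S m n \<omega> t\<bar>) / sqrt (real m)
      + 2 ^ p * (P.expectation (\<lambda>t. \<bar>f m \<omega> t\<bar>) / real J))"
    by simp
  also have "\<dots> \<le> \<bar>\<xi>\<bar> * (root 4 (gap_error p R J \<omega>) + 2 ^ p * root 4 (size_error p J \<omega>))"
    by (intro mult_left_mono add_mono step size) auto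
  finally have e1: "cmod (cf n \<omega> \<xi> - cf m \<omega> \<xi>) \<le> \<dots>" .

  define r where "r = \<lfloor>\<xi> * real J\<rfloor>"
  define \<eta> where "\<eta> = of_int r / real J"
  have r: "of_int r \<le> \<xi> * real J" "\<xi> * real J - 1 \<le> of_int r" unfolding r_def by linarith+
  have "\<xi> - \<eta> = (\<xi> * real J - of_int r) / real J"
    using J0 by (simp add: \<eta>_def diff_divide_distrib)
  then have "\<bar>\<xi> - \<eta>\<bar> = \<bar>\<xi> * real J - of_int r\<bar> / real J"
    by (simp add: abs_divide)
  also have "\<dots> \<le> 1 / real J" using r J0 by (intro divide_right_mono) auto
  finally have \<eta>: "\<bar>\<xi> - \<eta>\<bar> \<le> 1 / real J" .

  have "cmod (cf m \<omega> \<xi> - cf m \<omega> \<eta>) \<le> P.expectation (\<lambda>t. \<bar>\<xi> * f m \<omega> t - \<eta> * f m \<omega> t\<bar>)"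
    by (rule cf_diff_le)
  also have "\<dots> = \<bar>\<xi> - \<eta>\<bar> * P.expectation (\<lambda>t. \<bar>f m \<omega> t\<bar>)"
    by (simp add: abs_mult flip: left_diff_distrib)
  also have "\<dots> \<le> 1 / real J * P.expectation (\<lambda>t. \<bar>f m \<omega> t\<bar>)"
    by (intro mult_right_mono \<eta>) simp
  also have "\<dots> \<le> root 4 (size_error p J \<omega>)" using size by simp
  finally have e2: "cmod (cf m \<omega> \<xi> - cf m \<omega> \<eta>) \<le> root 4 (size_error p J \<omega>)" .

  have e3: "cmod (cf m \<omega> \<eta> - exp (- (\<eta>\<^sup>2 / 2))) \<le> sqrt (grid_error p J \<omega>)"
  proof (rule real_le_rsqrt)
    \<comment> \<open>The grid reaches up to J in absolute value;
      \<open>\<bar>\<xi>\<bar> + 1 \<le> real J\<close> leaves room for the rounding in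
      \<open>r\<close>.\<close>
    have "\<bar>of_int r\<bar> \<le> \<bar>\<xi> * real J\<bar> + 1" using r by linarith
    also have "\<dots> \<le> \<bar>\<xi>\<bar> * real J + real J" using J by (simp add: abs_mult)
    also have "\<dots> \<le> (real J)\<^sup>2"
      using mult_right_mono[OF J(2), of "real J"] by (simp add: power2_eq_square algebra_simps)
    finally have "\<bar>real_of_int r\<bar> \<le> real_of_int (int (J\<^sup>2))" by simp
    then have "\<bar>r\<bar> \<le> int (J\<^sup>2)" by linarith
    then have "r \<in> {- int (J\<^sup>2) .. int (J\<^sup>2)}" by (simp only: atLeastAtMost_iff) linarith
    then show "(cmod (cf m \<omega> \<eta> - exp (- (\<eta>\<^sup>2 / 2))))\<^sup>2 \<le> grid_error p J \<omega>"
      unfolding grid_error_def \<eta>_def m_def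
      by (rule member_le_sum[of r _ "\<lambda>r. (cmod (cf (J ^ p) \<omega> (of_int r / real J) - exp (- ((of_int r / real J)\<^sup>2 / 2))))\<^sup>2"]) auto
  qed

  have "\<bar>exp (- (\<eta>\<^sup>2 / 2)) - exp (- (\<xi>\<^sup>2 / 2))\<bar> \<le> \<bar>\<eta>\<^sup>2 / 2 - \<xi>\<^sup>2 / 2\<bar>"
    by (rule abs_exp_minus_diff_le) auto
  also have "\<dots> = \<bar>\<xi> - \<eta>\<bar> * (\<bar>\<eta> + \<xi>\<bar> / 2)"
  proof -
    have "\<eta>\<^sup>2 / 2 - \<xi>\<^sup>2 / 2 = - ((\<xi> - \<eta>) * ((\<eta> + \<xi>) / 2))"
      by (simp add: power2_eq_square field_simps)
    then show ?thesis by (simp only: abs_minus_cancel abs_mult abs_divide abs_numeral)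
  qed
  also have "\<dots> \<le> 1 / real J * (\<bar>\<xi>\<bar> + 1)"
  proof (intro mult_mono \<eta>)
    have "1 / real J \<le> 1" using J by simp
    with \<eta> have "\<bar>\<xi> - \<eta>\<bar> \<le> 1" by (rule order_trans)
    have "\<bar>\<eta> + \<xi>\<bar> \<le> \<bar>\<xi> - \<eta>\<bar> + 2 * \<bar>\<xi>\<bar>" by linarith
    also have "\<dots> \<le> 1 + 2 * \<bar>\<xi>\<bar>" by (rule add_right_mono) fact
    finally have "\<bar>\<eta> + \<xi>\<bar> \<le> 2 * (\<bar>\<xi>\<bar> + 1)" by simp
    then show "\<bar>\<eta> + \<xi>\<bar> / 2 \<le> \<bar>\<xi>\<bar> + 1" by simp
  qed auto
  finally have "cmod (complex_of_real (exp (- (\<eta>\<^sup>2 / 2)) - exp (- (\<xi>\<^sup>2 / 2)))) \<le> (\<bar>\<xi>\<bar> + 1) / real J"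
    by (simp only: norm_of_real) simp
  then have e4: "cmod (exp (- (\<eta>\<^sup>2 / 2)) - complex_of_real (exp (- (\<xi>\<^sup>2 / 2)))) \<le> (\<bar>\<xi>\<bar> + 1) / real J"
    by simp
  have tri: "cmod (u - z) \<le> cmod (u - v) + cmod (v - w) + cmod (w - x) + cmod (x - z)" for u v w x z :: complex
    using norm_triangle_ineq[of "u - v" "v - w"] norm_triangle_ineq[of "u - w" "w - x"]
      norm_triangle_ineq[of "u - x" "x - z"] by simp
  show ?thesis
    by (rule order_trans[OF tri[of _ _ "cf m \<omega> \<xi>" "cf m \<omega> \<eta>" "exp (- (\<eta>\<^sup>2 / 2))"]])
       (intro add_mono e1 e2 e3 e4)
qed

section \<open>Summable means of the three errors\<close>

lemma grid_error_measurable [measurable]: "grid_error p J \<in> borel_measurable M"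
  unfolding grid_error_def by measurable

lemma size_error_measurable [measurable]: "size_error p J \<in> borel_measurable M"
  unfolding size_error_def by measurable

lemma gap_error_measurable [measurable]: "gap_error p R J \<in> borel_measurable M"
  using Q_moment[THEN conjunct1, THEN borel_measurable_integrable] unfolding gap_error_def by measurable

text \<open>Budget of powers of J: at most 3 J^2 grid points, a factor 1 + \<xi>^4 of at most 2 J^4
  at each, and J^(-8) from the choice of \<open>p\<close>, which leaves the summable J^(-2).\<close>

lemma grid_error_moment:
  assumes decay: "\<And>k::int. k \<noteq> 0 \<Longrightarrow> cmod (char P (of_int k)) \<le> C / \<bar>of_int k\<bar> powr \<alpha>"
    and \<alpha>: "0 < \<alpha>" and C: "0 \<le> C" and J: "1 \<le> J" and p: "8 \<le> real p * min (1/4) (\<alpha>/2)"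
  shows "(\<integral>\<^sup>+\<omega>. ennreal (norm (grid_error p J \<omega>)) \<partial>M) \<le> ennreal (6 * (192 * \<kappa> + 3 + C\<^sup>2) * (1 / (real J)\<^sup>2))"
proof -
  define A where "A = 192 * \<kappa> + 3 + C\<^sup>2"
  define I where "I = {- int (J\<^sup>2) .. int (J\<^sup>2)}"
  define e where "e r \<omega> = (cmod (cf (J ^ p) \<omega> (of_int r / real J) - exp (- ((of_int r / real J)\<^sup>2 / 2))))\<^sup>2" for r :: int and \<omega>
  have A: "0 \<le> A" using kappa by (simp add: A_def)
  have [measurable]: "e r \<in> borel_measurable M" for r unfolding e_def by measurable
  have single: "(\<integral>\<^sup>+\<omega>. ennreal (e r \<omega>) \<partial>M) \<le> ennreal (2 * A / real J ^ 4)" if r: "r \<in> I" for r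
  proof -
    have "(\<integral>\<^sup>+\<omega>. ennreal (e r \<omega>) \<partial>M)
        \<le> ennreal (A * (1 + (of_int r / real J) ^ 4) * real (J ^ p) powr - min (1/4) (\<alpha>/2))"
      unfolding e_def A_def using J by (intro cf_second_moment[OF decay \<alpha> C]) auto
    also have "\<dots> \<le> ennreal (A * (2 * real J ^ 4) * (1 / real J ^ 8))"
    proof (intro ennreal_leI mult_mono)
      have "\<bar>real_of_int r\<bar> \<le> real_of_int (int (J\<^sup>2))"
        using r unfolding I_def atLeastAtMost_iff by linarith
      then have "\<bar>real_of_int r / real J\<bar> \<le> (real J)\<^sup>2 / real J"
        by (simp add: divide_right_mono)
      then have "\<bar>real_of_int r / real J\<bar> \<le> real J" using J by (simp add: power2_eq_square)
      then have "\<bar>real_of_int r / real J\<bar> ^ 4 \<le> real J ^ 4" by (intro power_mono) auto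
      then have "(real_of_int r / real J) ^ 4 \<le> real J ^ 4" by (simp only: power_even_abs_numeral even_numeral)
      moreover have "1 \<le> real J ^ 4" using J by simp
      ultimately show "1 + (of_int r / real J) ^ 4 \<le> 2 * real J ^ 4" by linarith
      have "real (J ^ p) powr - min (1/4) (\<alpha>/2) = real J powr (- (real p * min (1/4) (\<alpha>/2)))"
        using J by (simp add: powr_powr flip: powr_realpow)
      also have "\<dots> \<le> real J powr (- 8)"
        using J p by (intro powr_mono) auto
      also have "\<dots> = 1 / real J ^ 8"
        using J by (simp add: powr_minus divide_inverse)
      finally show "real (J ^ p) powr - min (1/4) (\<alpha>/2) \<le> 1 / real J ^ 8" .
    qed (auto simp: A)
    also have "A * (2 * real J ^ 4) * (1 / real J ^ 8) = 2 * A / real J ^ 4"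
      using J by (simp add: field_simps flip: power_add)
    finally show ?thesis .
  qed
  have "(\<integral>\<^sup>+\<omega>. ennreal (norm (grid_error p J \<omega>)) \<partial>M) = (\<integral>\<^sup>+\<omega>. (\<Sum>r\<in>I. ennreal (e r \<omega>)) \<partial>M)"
    by (intro nn_integral_cong) (simp add: grid_error_def e_def I_def sum_nonneg sum_ennreal)
  also have "\<dots> = (\<Sum>r\<in>I. \<integral>\<^sup>+\<omega>. ennreal (e r \<omega>) \<partial>M)"
    by (rule nn_integral_sum) simp
  also have "\<dots> \<le> (\<Sum>r\<in>I. ennreal (2 * A / real J ^ 4))"
    by (intro sum_mono single)
  also have "\<dots> = ennreal (\<Sum>r\<in>I. 2 * A / real J ^ 4)"
    using A by (intro sum_ennreal) auto
  also have "\<dots> \<le> ennreal (6 * A * (1 / (real J)\<^sup>2))"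
  proof (rule ennreal_leI)
    have "1 \<le> (real J)\<^sup>2" using J by simp
    have "(\<Sum>r\<in>I. 2 * A / real J ^ 4) = real (2 * J\<^sup>2 + 1) * (2 * A / real J ^ 4)"
      by (simp add: I_def nat_add_distrib nat_mult_distrib nat_power_eq)
    also have "\<dots> \<le> (3 * (real J)\<^sup>2) * (2 * A / real J ^ 4)"
      using A \<open>1 \<le> (real J)\<^sup>2\<close> by (intro mult_right_mono) auto
    also have "\<dots> = 6 * A * (1 / (real J)\<^sup>2)"
      using J by (simp add: power2_eq_square power4_eq_xxxx)
    finally show "(\<Sum>r\<in>I. 2 * A / real J ^ 4) \<le> 6 * A * (1 / (real J)\<^sup>2)" .
  qed
  finally show ?thesis unfolding A_def .
qed

lemma size_error_moment:
  assumes J: "1 \<le> J"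
  shows "(\<integral>\<^sup>+\<omega>. ennreal (norm (size_error p J \<omega>)) \<partial>M) \<le> ennreal (12 * \<kappa> * (1 / (real J)\<^sup>2))"
proof -
  define m where "m = real (J ^ p)"
  have m: "0 < m" using J by (simp add: m_def)
  have "(\<integral>\<^sup>+\<omega>. ennreal (norm (size_error p J \<omega>)) \<partial>M) = (\<integral>\<^sup>+\<omega>. ennreal (size_error p J \<omega>) \<partial>M)"
    by (simp add: size_error_def d_nonneg)
  also have "\<dots> = ennreal (M.expectation (size_error p J))"
    unfolding size_error_def by (intro nn_integral_eq_integral) (auto simp: d_nonneg intro!: d_moment(1))
  also have "M.expectation (size_error p J) = M.expectation (d 0 (J ^ p)) / m\<^sup>2 / real J ^ 4"
    by (simp add: size_error_def[abs_def] m_def)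
  also have "\<dots> \<le> 12 * \<kappa> * m\<^sup>2 / m\<^sup>2 / real J ^ 4"
    using d_moment(2)[of 0 "J ^ p"] by (intro divide_right_mono) (auto simp: m_def)
  also have "\<dots> = 12 * \<kappa> * (1 / real J ^ 4)" using m by simp
  \<comment> \<open>Weakened on purpose, so that all three errors share one summable
    sequence.\<close>
  also have "\<dots> \<le> 12 * \<kappa> * (1 / (real J)\<^sup>2)"
    using J kappa by (intro mult_left_mono divide_left_mono power_increasing) auto
  finally show ?thesis by (simp add: ennreal_leI)
qed

text \<open>The block exceeds the gap bound by at most a factor 2, so the 4^R of
  \<open>Q_moment\<close> costs a factor 4 (6000 = 4 * 1500), and dividing by J^(2p) leaves the
  square of the relative gap.\<close>

lemma gap_error_moment:
  assumes J: "1 \<le> J" and R: "2 ^ R \<le> 2 * (2 ^ p * real (J ^ p) / real J)"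
  shows "(\<integral>\<^sup>+\<omega>. ennreal (norm (gap_error p R J \<omega>)) \<partial>M) \<le> ennreal (6000 * \<kappa> * (2 ^ p)\<^sup>2 * (1 / (real J)\<^sup>2))"
proof -
  define m where "m = real (J ^ p)"
  have m: "0 < m" using J by (simp add: m_def)
  have "(\<integral>\<^sup>+\<omega>. ennreal (norm (gap_error p R J \<omega>)) \<partial>M) = (\<integral>\<^sup>+\<omega>. ennreal (gap_error p R J \<omega>) \<partial>M)"
    by (simp add: gap_error_def Q_nonneg)
  also have "\<dots> = ennreal (M.expectation (gap_error p R J))"
    unfolding gap_error_def by (intro nn_integral_eq_integral) (auto simp: Q_nonneg intro!: Q_moment[THEN conjunct1])
  also have "M.expectation (gap_error p R J) = M.expectation (Q R (J ^ p)) / m\<^sup>2"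
    by (simp add: gap_error_def[abs_def] m_def)
  also have "\<dots> \<le> 1500 * \<kappa> * 4 ^ R / m\<^sup>2"
    by (intro divide_right_mono Q_moment[THEN conjunct2]) simp
  also have "(4::real) ^ R = (2 ^ R)\<^sup>2"
    by (simp add: power2_eq_square flip: power_mult_distrib)
  also have "1500 * \<kappa> * (2 ^ R)\<^sup>2 / m\<^sup>2 \<le> 1500 * \<kappa> * (2 * (2 ^ p * m / real J))\<^sup>2 / m\<^sup>2"
    using kappa R by (intro divide_right_mono mult_left_mono power_mono) (auto simp: m_def)
  also have "\<dots> = 6000 * \<kappa> * (2 ^ p)\<^sup>2 * (1 / (real J)\<^sup>2)"
    using m J by (simp add: power_mult_distrib power_divide)
  finally show ?thesis by (simp add: ennreal_leI)
qed

section \<open>Almost sure convergence of the characteristic functions\<close>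

lemma AE_cf_tendsto:
  assumes decay: "\<And>k::int. k \<noteq> 0 \<Longrightarrow> cmod (char P (of_int k)) \<le> C / \<bar>of_int k\<bar> powr \<alpha>"
    and \<alpha>: "0 < \<alpha>" and C: "0 \<le> C"
  shows "AE \<omega> in M. \<forall>\<xi>. (\<lambda>n. cf n \<omega> \<xi>) \<longlonglongrightarrow> exp (- (\<xi>\<^sup>2 / 2))"
proof -
  define \<delta> where "\<delta> = min (1/4) (\<alpha>/2)"
  have \<delta>: "0 < \<delta>" using \<alpha> by (simp add: \<delta>_def)
  obtain p :: nat where p': "8 / \<delta> < real p" using reals_Archimedean2 by blast
  then have p: "8 \<le> real p * \<delta>" using \<delta> by (simp add: field_simps)
  have p1: "1 \<le> p" using p by (cases p) auto
  have "\<exists>r. 2 ^ p * real (J ^ p) / real J \<le> 2 ^ r \<and> 2 ^ r \<le> 2 * (2 ^ p * real (J ^ p) / real J)" if "1 \<le> J" for J :: nat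
  proof (rule ex_dyadic_between)
    have "real J \<le> real J ^ p" using power_increasing[of 1 p "real J"] that p1 by simp
    also have "\<dots> \<le> 2 ^ p * real J ^ p" using mult_right_mono[of 1 "2 ^ p" "real J ^ p"] by simp
    finally show "1 \<le> 2 ^ p * real (J ^ p) / real J" using that by (simp add: le_divide_eq)
  qed
  then obtain R :: "nat \<Rightarrow> nat" where
    R: "\<And>J. 1 \<le> J \<Longrightarrow> 2 ^ p * real (J ^ p) / real J \<le> 2 ^ R J"
       "\<And>J. 1 \<le> J \<Longrightarrow> 2 ^ R J \<le> 2 * (2 ^ p * real (J ^ p) / real J)"
    by metis
  \<comment> \<open>\<open>F n\<close> is the integer part of the p-th root of \<open>n\<close>, the
    index of the subsequence term just below \<open>n\<close>.\<close>
  obtain F :: "nat \<Rightarrow> nat" where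
    F: "\<And>n. 1 \<le> n \<Longrightarrow> 1 \<le> F n" "\<And>n. 1 \<le> n \<Longrightarrow> F n ^ p \<le> n" "\<And>n. 1 \<le> n \<Longrightarrow> n < (F n + 1) ^ p"
    using ex_floor_root[OF p1] by metis
  have F_top: "filterlim F at_top sequentially"
    unfolding filterlim_at_top
  proof
    fix K
    show "\<forall>\<^sub>F n in sequentially. K \<le> F n"
      using eventually_ge_at_top[of "max 1 (K ^ p)"]
    proof eventually_elim
      case (elim n)
      then have "K ^ p < (F n + 1) ^ p" using F(3)[of n] by auto
      then have "K < F n + 1" by (rule power_less_imp_less_base) simp
      then show ?case by simp
    qed
  qed
  have summ: "summable (\<lambda>j. c * (1 / (real (Suc j))\<^sup>2))" for c :: real
    using inverse_power_summable[of 2, where 'a=real]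
    by (intro summable_mult) (subst summable_Suc_iff[of "\<lambda>j. 1 / (real j)\<^sup>2"], simp add: divide_inverse)
  have "AE \<omega> in M. (\<lambda>j. grid_error p (Suc j) \<omega>) \<longlonglongrightarrow> 0"
    by (rule AE_tendsto_zero_of_summable_nn_integral[OF _ grid_error_moment[OF decay \<alpha> C] _ summ])
       (use p kappa in \<open>auto simp: \<delta>_def\<close>)
  moreover have "AE \<omega> in M. (\<lambda>j. size_error p (Suc j) \<omega>) \<longlonglongrightarrow> 0"
    by (rule AE_tendsto_zero_of_summable_nn_integral[OF _ size_error_moment _ summ]) (use kappa in auto)
  moreover have "AE \<omega> in M. (\<lambda>j. gap_error p (R (Suc j)) (Suc j) \<omega>) \<longlonglongrightarrow> 0"
    by (rule AE_tendsto_zero_of_summable_nn_integral[OF _ gap_error_moment[OF _ R(2)] _ summ])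
       (use kappa in auto)
  ultimately show ?thesis
  proof eventually_elim
    case (elim \<omega>)
    have lim: "(\<lambda>J. grid_error p J \<omega>) \<longlonglongrightarrow> 0" "(\<lambda>J. size_error p J \<omega>) \<longlonglongrightarrow> 0"
      "(\<lambda>J. gap_error p (R J) J \<omega>) \<longlonglongrightarrow> 0"
      using elim by (auto intro: LIMSEQ_imp_Suc)
    show ?case
    proof
      fix \<xi> :: real
      define b where "b J = \<bar>\<xi>\<bar> * (root 4 (gap_error p (R J) J \<omega>) + 2 ^ p * root 4 (size_error p J \<omega>))
        + root 4 (size_error p J \<omega>) + sqrt (grid_error p J \<omega>) + (\<bar>\<xi>\<bar> + 1) / real J" for J
      have "b \<longlonglongrightarrow> \<bar>\<xi>\<bar> * (root 4 0 + 2 ^ p * root 4 0) + root 4 0 + sqrt 0 + 0"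
        unfolding b_def by (intro tendsto_intros lim lim_const_over_n)
      then have "b \<longlonglongrightarrow> 0" by simp
      then have "(\<lambda>n. b (F n)) \<longlonglongrightarrow> 0" by (rule filterlim_compose[OF _ F_top])
      \<comment> \<open>How large \<open>n\<close> must be depends on \<xi>, but the null set was
        fixed before \<xi> was chosen.\<close>
      moreover have "\<forall>\<^sub>F n in sequentially. cmod (cf n \<omega> \<xi> - exp (- (\<xi>\<^sup>2 / 2))) \<le> b (F n)"
        using eventually_ge_at_top[of 1] F_top[unfolded filterlim_at_top, rule_format, of "nat \<lceil>\<bar>\<xi>\<bar> + 1\<rceil>"]
      proof eventually_elim
        case (elim n)
        then have "\<bar>\<xi>\<bar> + 1 \<le> real (F n)" by linarith
        then show ?case
          unfolding b_def by (intro cf_error_le F R elim)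
      qed
      ultimately have "(\<lambda>n. cf n \<omega> \<xi> - exp (- (\<xi>\<^sup>2 / 2))) \<longlonglongrightarrow> 0"
        by (rule Lim_null_comparison[rotated])
      then show "(\<lambda>n. cf n \<omega> \<xi>) \<longlonglongrightarrow> exp (- (\<xi>\<^sup>2 / 2))"
        by (rule LIM_zero_cancel)
    qed
  qed
qed

end

theorem theorem4:
  fixes M :: "'a measure" and N :: "'b measure"
    and a b :: "nat \<Rightarrow> 'a \<Rightarrow> real"
    and X :: "'b \<Rightarrow> real"
    and \<alpha> \<beta> C :: real
  assumes M: "prob_space M"
    and meas_a: "\<And>k. k \<ge> 1 \<Longrightarrow> a k \<in> borel_measurable M"
    and meas_b: "\<And>k. k \<ge> 1 \<Longrightarrow> b k \<in> borel_measurable M"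
    and indep: "prob_space.indep_vars M (\<lambda>_. borel)
                  (\<lambda>i. case i of Inl k \<Rightarrow> a k | Inr k \<Rightarrow> b k) ({1..} <+> {1..})"
    and distr_a: "\<And>k. k \<ge> 1 \<Longrightarrow> distr M borel (a k) = distr M borel (a 1)"
    and distr_b: "\<And>k. k \<ge> 1 \<Longrightarrow> distr M borel (b k) = distr M borel (a 1)"
    and centered: "prob_space.expectation M (a 1) = 0"
    and unit_var: "prob_space.expectation M (\<lambda>\<omega>. (a 1 \<omega>)\<^sup>2) = 1"
    and beta_ge: "\<beta> \<ge> 3"
    and moment: "integrable M (\<lambda>\<omega>. \<bar>a 1 \<omega>\<bar> powr \<beta>)"
    and N: "prob_space N"
    and meas_X: "X \<in> borel_measurable N"
    and X_range: "\<forall>x\<in>space N. X x \<in> {0..2*pi}"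
    and alpha_pos: "\<alpha> > 0"
    and C_pos: "C > 0"
    and fourier: "\<And>k::int. k \<noteq> 0 \<Longrightarrow>
                    norm (char (distr N borel X) (real_of_int k)) \<le> C / \<bar>real_of_int k\<bar> powr \<alpha>"
    and beta_big: "\<beta> > 2 / min \<alpha> (1/2)"
  shows "AE \<omega> in M. weak_conv_m (\<lambda>n. distr N borel (\<lambda>x. trig_poly a b n \<omega> (X x)))
                                   std_normal_distribution"
proof -
  interpret M: prob_space M by (rule M)
  interpret N: prob_space N by (rule N)
  define P where "P = distr N borel X"
  define U where "U i = (case i of Inl k \<Rightarrow> a k | Inr k \<Rightarrow> b k)" for i
  \<comment> \<open>The added 1 makes both \<open>1 \<le> \<kappa>\<close> and the fourth-moment
    bound immediate.\<close>
  define \<kappa> where "\<kappa> = 1 + M.expectation (\<lambda>\<omega>. a 1 \<omega> ^ 4)"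
  note [measurable] = meas_a[of 1, simplified] meas_X

  have "4 \<le> 2 / min \<alpha> (1/2)" using alpha_pos by (simp add: min_def field_simps)
  then have beta4: "4 \<le> \<beta>" using beta_big by (rule order_trans[OF _ less_imp_le])
  have int4: "integrable M (\<lambda>\<omega>. a 1 \<omega> ^ 4)"
  proof (rule Bochner_Integration.integrable_bound[of _ "\<lambda>\<omega>. 1 + \<bar>a 1 \<omega>\<bar> powr \<beta>"])
    have "\<bar>y\<bar> ^ 4 \<le> 1 + \<bar>y\<bar> powr \<beta>" for y :: real
    proof (cases "\<bar>y\<bar> \<le> 1")
      case True
      then have "\<bar>y\<bar> ^ 4 \<le> 1" by (intro power_le_one) auto
      moreover have "0 \<le> \<bar>y\<bar> powr \<beta>" by simp
      ultimately show ?thesis by linarith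
    next
      case False
      then have "\<bar>y\<bar> ^ 4 = \<bar>y\<bar> powr 4" by simp
      also have "\<dots> \<le> \<bar>y\<bar> powr \<beta>" using False beta4 by (intro powr_mono) auto
      finally show ?thesis by simp
    qed
    then show "AE \<omega> in M. norm (a 1 \<omega> ^ 4) \<le> norm (1 + \<bar>a 1 \<omega>\<bar> powr \<beta>)"
      by (simp add: power_abs)
  qed (use moment in auto)
  have U_law: "U i \<in> borel_measurable M \<and> distr M borel (U i) = distr M borel (a 1)"
    if "i \<in> {1..} <+> {1..}" for i
  proof (cases i)
    case (Inl k)
    with that have "1 \<le> k" by auto
    from meas_a[OF this] distr_a[OF this] show ?thesis unfolding U_def Inl sum.case ..
  next
    case (Inr k)
    with that have "1 \<le> k" by auto
    from meas_b[OF this] distr_b[OF this] show ?thesis unfolding U_def Inr sum.case ..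
  qed
  note U_meas = U_law[THEN conjunct1] and U_distr = U_law[THEN conjunct2]
  have U_moment: "M.expectation (\<lambda>\<omega>. U i \<omega> ^ k) = M.expectation (\<lambda>\<omega>. a 1 \<omega> ^ k)" if "i \<in> {1..} <+> {1..}" for i k
  proof -
    have "M.expectation (\<lambda>\<omega>. U i \<omega> ^ k) = (\<integral>x. x ^ k \<partial>distr M borel (U i))"
      using U_meas[OF that] by (simp add: integral_distr)
    also have "\<dots> = M.expectation (\<lambda>\<omega>. a 1 \<omega> ^ k)"
      unfolding U_distr[OF that] by (simp add: integral_distr)
    finally show ?thesis .
  qed
  have U_int: "integrable M (\<lambda>\<omega>. U i \<omega> ^ 4)" if "i \<in> {1..} <+> {1..}" for i
  proof -
    have "integrable (distr M borel (U i)) (\<lambda>x. x ^ 4)"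
      unfolding U_distr[OF that] using int4 by (simp add: integrable_distr_eq)
    then show ?thesis using U_meas[OF that] by (simp add: integrable_distr_eq)
  qed
  interpret P: real_distribution P
    unfolding P_def by (rule N.real_distribution_distr) (rule meas_X)
  interpret random_trig_sum M P U \<kappa>
  proof unfold_locales
    show "M.indep_vars (\<lambda>_. borel) U ({1..} <+> {1..})"
      using indep by (simp add: U_def[abs_def])
    show "M.expectation (U i) = 0" if "i \<in> {1..} <+> {1..}" for i
      using U_moment[OF that, of 1] centered by simp
    show "M.expectation (\<lambda>\<omega>. (U i \<omega>)\<^sup>2) = 1" if "i \<in> {1..} <+> {1..}" for i
      unfolding U_moment[OF that] by (rule unit_var)
    show "M.expectation (\<lambda>\<omega>. U i \<omega> ^ 4) \<le> \<kappa>" if "i \<in> {1..} <+> {1..}" for i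
      unfolding U_moment[OF that] by (simp add: \<kappa>_def)
    show "1 \<le> \<kappa>"
      unfolding \<kappa>_def by (simp add: integral_nonneg_AE)
  qed (rule U_int)
  have f_eq: "f n \<omega> t = trig_poly a b n \<omega> t" for n \<omega> t
    by (simp add: f_def S_def trig_poly_def trig_def U_def sum.Plus sum.distrib
        atLeastSucAtMost_greaterThanAtMost mult.commute)
  have "AE \<omega> in M. \<forall>\<xi>. (\<lambda>n. cf n \<omega> \<xi>) \<longlonglongrightarrow> exp (- (\<xi>\<^sup>2 / 2))"
    using fourier C_pos by (intro AE_cf_tendsto[OF _ alpha_pos]) (auto simp: P_def)
  then show ?thesis
  proof eventually_elim
    case (elim \<omega>)
    have eq: "distr N borel (\<lambda>x. trig_poly a b n \<omega> (X x)) = distr P borel (f n \<omega>)" for n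
      unfolding P_def f_eq[symmetric] by (subst distr_distr) (auto simp: comp_def)
    show ?case
      unfolding eq
    proof (rule levy_continuity)
      show "real_distribution (distr P borel (f n \<omega>))" for n
        by (rule P.real_distribution_distr) simp
      show "real_distribution std_normal_distribution"
        by (rule real_dist_normal_dist)
      show "(\<lambda>n. char (distr P borel (f n \<omega>)) t) \<longlonglongrightarrow> char std_normal_distribution t" for t
        using elim[rule_format, of t]
        by (simp add: char_std_normal_distribution char_def cf_def integral_distr)
    qed
  qed
qed

end
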